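(* There exist absolute constants $c>0$ and $n_0$ such that for all integers $n\ge n_0$ and $m$ with $n^{0.99}\le m\le n/6$ the following holds. There exists a probability distribution $\mathcal{D}$ over random variables (distributions) $\overline{X}$ on $\{0,1\}^n$, each of min-entropy at least $1.5m$, such that for every function $h\colon\{0,1\}^n\to\{0,1\}^m$ of sparsity at most $0.001\, n\log_2 m\log_2(2n/m)$, \[ \mathbb{E}_{\overline{X}\sim\mathcal{D}}\bigl[\,\mathrm{SD}\bigl(h(\overline{X}),U_m\bigr)\bigr]\ \ge\ 1-e^{-m^{c}}, \] where $U_m$ is uniform on $\{0,1\}^m$ and $\mathrm{SD}$ denotes statistical distance.
   Context: For $h\colon\{0,1\}^n\to\{0,1\}^m$, output $j$ depends on input $i$ if there exist $x,x'\in\{0,1\}^n$ differing only in coordinate $i$ with $h(x)_j\ne h(x')_j$. The sparsity of $h$ is the number of pairs $(i,j)$ such that output $j$ depends on input $i$; $h$ is $s$-sparse if its sparsity is at most $s$. The min-entropy of $X$ is $\min_x\log_2(1/\Pr[X=x])$. The statistical distance between $A,B$ on a finite set is $\frac12\sum_\omega|\Pr[A=\omega]-\Pr[B=\omega]|$. *)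

theory Defs
  imports "HOL-Probability.Probability"
begin

definition bitstrings :: "nat \<Rightarrow> bool list set" where
  "bitstrings k = {xs. length xs = k}"

definition depends_on :: "nat \<Rightarrow> (bool list \<Rightarrow> bool list) \<Rightarrow> nat \<Rightarrow> nat \<Rightarrow> bool" where
  "depends_on n h i j \<longleftrightarrow> (\<exists>x x'. x \<in> bitstrings n \<and> x' \<in> bitstrings n \<and>
      (\<forall>k. k \<noteq> i \<longrightarrow> x ! k = x' ! k) \<and> h x ! j \<noteq> h x' ! j)"

definition sparsity :: "nat \<Rightarrow> nat \<Rightarrow> (bool list \<Rightarrow> bool list) \<Rightarrow> nat" where
  "sparsity n m h = card {(i, j). i < n \<and> j < m \<and> depends_on n h i j}"

definition min_entropy :: "'a pmf \<Rightarrow> real" where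
  "min_entropy X = (INF x\<in>set_pmf X. log 2 (1 / pmf X x))"

text \<open>Statistical distance of two finitely supported distributions.\<close>
definition stat_dist :: "'a pmf \<Rightarrow> 'a pmf \<Rightarrow> real" where
  "stat_dist A B = (1/2) * (\<Sum>\<omega>\<in>set_pmf A \<union> set_pmf B. \<bar>pmf A \<omega> - pmf B \<omega>\<bar>)"

definition uniform_bits :: "nat \<Rightarrow> bool list pmf" where
  "uniform_bits m = pmf_of_set (bitstrings m)"

end

theory Submission
  imports Defs "HOL-Real_Asymp.Real_Asymp"
begin

text \<open>
  Cut the input into \<open>N\<close> blocks of \<open>2 ^ k - 1\<close> bits. A source is given by a uniform string \<open>r\<close> and by
  a random set of active blocks (density 3/8); it outputs \<open>r\<close> after flipping, in each active block,
  one of the \<open>2 ^ k - 1\<close> bits or none, so that each active block carries \<open>k\<close> bits of entropy. Taking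
  \<open>k\<close> about \<open>log (n / m)\<close>, only about \<open>m / log (n / m)\<close> bits of \<open>r\<close> are flipped.

  The distinguisher tests whether its argument is correlated with \<open>h r\<close>. By Fourier analysis the
  correlation of an output depending on \<open>d\<close> inputs is at least \<open>4 powr (- d / 2 ^ k)\<close>; the sparsity
  bound and convexity make the sum over all outputs at least \<open>m powr 0.85\<close>. The bounded differences
  inequality turns this into a statement with exponentially small error, provided that no input
  influences more than \<open>m powr 0.33\<close> outputs. The few inputs that do are treated by a union bound:
  the test accepts if there is a correlation with \<open>h z\<close> for some \<open>z\<close> that agrees with \<open>r\<close> on all the
  other inputs. A uniform string passes this test with exponentially small probability.
\<close>

subsection \<open>Bounded differences on finite product spaces\<close>

abbreviation (input) expect :: "'a pmf \<Rightarrow> ('a \<Rightarrow> real) \<Rightarrow> real" where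
  "expect p f \<equiv> measure_pmf.expectation p f"

lemma expect_bind_finite:
  assumes "finite (set_pmf p)" "\<And>x. x \<in> set_pmf p \<Longrightarrow> finite (set_pmf (q x))"
  shows "expect (bind_pmf p q) f = expect p (\<lambda>x. expect (q x) f)"
proof -
  have "expect (bind_pmf p q) f = (\<Sum>a\<in>set_pmf p. pmf p a *\<^sub>R expect (q a) f)"
    by (rule pmf_expectation_bind) (use assms in auto)
  also have "\<dots> = expect p (\<lambda>x. expect (q x) f)"
    using assms(1) by (simp add: integral_measure_pmf[of "set_pmf p"])
  finally show ?thesis .
qed

lemma expect_pair_finite:
  assumes "finite (set_pmf p)" "finite (set_pmf q)"
  shows "expect (pair_pmf p q) f = expect p (\<lambda>x. expect q (\<lambda>y. f (x, y)))"
  unfolding pair_pmf_def using assms by (simp add: expect_bind_finite)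

lemma expect_swap_finite:
  assumes "finite (set_pmf p)" "finite (set_pmf q)"
  shows "expect p (\<lambda>x. expect q (\<lambda>y. f x y)) = expect q (\<lambda>y. expect p (\<lambda>x. f x y))"
proof -
  have "expect p (\<lambda>x. expect q (\<lambda>y. f x y)) = expect (pair_pmf p q) (\<lambda>(x, y). f x y)"
    using assms by (simp add: expect_pair_finite)
  also have "\<dots> = expect (pair_pmf q p) (\<lambda>(y, x). f x y)"
    by (subst pair_commute_pmf) (simp add: case_prod_unfold)
  also have "\<dots> = expect q (\<lambda>y. expect p (\<lambda>x. f x y))"
    using assms by (simp add: expect_pair_finite)
  finally show ?thesis .
qed

lemma expect_mono_finite:
  assumes "finite (set_pmf p)" "\<And>x. x \<in> set_pmf p \<Longrightarrow> f x \<le> g x"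
  shows "expect p f \<le> expect p g"
  using assms by (intro integral_mono_AE) (auto simp: AE_measure_pmf_iff integrable_measure_pmf_finite)

lemma finite_set_Pi_pmf:
  assumes "finite I" "\<And>i. i \<in> I \<Longrightarrow> finite (set_pmf (p i))"
  shows "finite (set_pmf (Pi_pmf I d p))"
  using assms by (auto simp: set_Pi_pmf)

lemma expect_Pi_pmf_insert:
  assumes "finite I" "i \<notin> I" "\<And>j. j \<in> insert i I \<Longrightarrow> finite (set_pmf (p j))"
  shows "expect (Pi_pmf (insert i I) d p) f =
    expect (Pi_pmf I d p) (\<lambda>y. expect (p i) (\<lambda>v. f (y(i := v))))"
proof -
  have fin: "finite (set_pmf (Pi_pmf I d p))" "finite (set_pmf (p i))"
    using assms by (auto intro: finite_set_Pi_pmf)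
  have "expect (Pi_pmf (insert i I) d p) f =
      expect (p i) (\<lambda>v. expect (Pi_pmf I d p) (\<lambda>y. f (y(i := v))))"
    using assms fin by (simp add: Pi_pmf_insert case_prod_unfold expect_pair_finite)
  then show ?thesis
    using expect_swap_finite[OF fin(2,1)] by simp
qed

lemma expect_prod_Pi_pmf:
  fixes f :: "'a \<Rightarrow> 'b \<Rightarrow> real"
  assumes "finite I" "\<And>i. i \<in> I \<Longrightarrow> finite (set_pmf (p i))"
  shows "expect (Pi_pmf I d p) (\<lambda>y. \<Prod>i\<in>I. f i (y i)) = (\<Prod>i\<in>I. expect (p i) (f i))"
  using assms
proof (induction I rule: finite_induct)
  case empty
  then show ?case by simp
next
  case (insert i I)
  have "expect (Pi_pmf (insert i I) d p) (\<lambda>y. \<Prod>i\<in>insert i I. f i (y i)) =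
      expect (Pi_pmf I d p) (\<lambda>y. expect (p i) (\<lambda>v. f i v * (\<Prod>j\<in>I. f j ((y(i := v)) j))))"
    using insert by (subst expect_Pi_pmf_insert) auto
  also have "\<dots> = expect (Pi_pmf I d p) (\<lambda>y. expect (p i) (\<lambda>v. f i v * (\<Prod>j\<in>I. f j (y j))))"
  proof -
    have "(\<Prod>j\<in>I. f j ((y(i := v)) j)) = (\<Prod>j\<in>I. f j (y j))" for y v
      using insert.hyps by (intro prod.cong) auto
    then show ?thesis by simp
  qed
  also have "\<dots> = expect (p i) (f i) * (\<Prod>j\<in>I. expect (p j) (f j))"
    using insert by simp
  finally show ?case using insert by simp
qed

text \<open>Hoeffding's lemma for an interval of width \<open>2 * c\<close>. Its centre
  \<open>w\<close> need not be the mean, so any reference value of \<open>f\<close> can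
  serve.\<close>

lemma expect_exp_bounded:
  fixes f :: "'a \<Rightarrow> real"
  assumes "finite (set_pmf p)" "\<And>x. \<bar>f x - w\<bar> \<le> c" "l > 0"
  shows "expect p (\<lambda>x. exp (l * f x)) \<le> exp (l * expect p f + l\<^sup>2 * c\<^sup>2 / 2)"
proof -
  interpret interval_bounded_random_variable "measure_pmf p" f "w - c" "w + c"
    by unfold_locales (use assms(2) in \<open>auto simp: abs_le_iff intro!: AE_I2\<close>, (smt (verit))+)
  have "nn_integral p (\<lambda>x. exp (l * (f x - expect p f))) \<le> exp (l\<^sup>2 * (w + c - (w - c))\<^sup>2 / 8)"
    using Hoeffdings_lemma_nn_integral[OF \<open>l > 0\<close>] by simp
  moreover have "nn_integral p (\<lambda>x. exp (l * (f x - expect p f))) =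
      ennreal (expect p (\<lambda>x. exp (l * (f x - expect p f))))"
    by (intro nn_integral_eq_integral integrable_measure_pmf_finite assms) auto
  ultimately have "expect p (\<lambda>x. exp (l * (f x - expect p f))) \<le> exp (l\<^sup>2 * c\<^sup>2 / 2)"
    by (simp add: power_mult_distrib mult.commute)
  moreover have "expect p (\<lambda>x. exp (l * (f x - expect p f))) =
      expect p (\<lambda>x. exp (l * f x)) / exp (l * expect p f)"
    by (simp add: right_diff_distrib exp_diff)
  ultimately have "expect p (\<lambda>x. exp (l * f x)) / exp (l * expect p f) \<le> exp (l\<^sup>2 * c\<^sup>2 / 2)"
    by simp
  then show ?thesis
    by (simp add: exp_add pos_divide_le_eq mult.commute)
qed

text \<open>Averaging out one coordinate preserves the difference bound in the others, and
  Hoeffding's lemma charges one factor \<open>exp (l^2 * c^2 / 2)\<close> for it. Exponential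
  moments, unlike tail bounds, can be estimated in stages: first over the inputs, then over the
  noise.\<close>

lemma expect_exp_bounded_differences:
  fixes f :: "('i \<Rightarrow> 'a) \<Rightarrow> real"
  assumes "finite I" "\<And>i. i \<in> I \<Longrightarrow> finite (set_pmf (p i))"
    and "\<And>x i v. i \<in> I \<Longrightarrow> \<bar>f (x(i := v)) - f x\<bar> \<le> c" "l > 0"
  shows "expect (Pi_pmf I d p) (\<lambda>x. exp (l * f x)) \<le>
    exp (l * expect (Pi_pmf I d p) f + l\<^sup>2 * c\<^sup>2 / 2 * card I)"
  using assms
proof (induction I arbitrary: f rule: finite_induct)
  case empty
  then show ?case by simp
next
  case (insert i I)
  define g where "g y = expect (p i) (\<lambda>v. f (y(i := v)))" for y
  have fin: "finite (set_pmf (Pi_pmf I d p))" "finite (set_pmf (p i))"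
    using insert by (auto intro: finite_set_Pi_pmf)
  have g: "\<bar>g (y(j := v)) - g y\<bar> \<le> c" if "j \<in> I" for y j v
  proof -
    have "i \<noteq> j" using that insert.hyps by auto
    have "g (y(j := v)) - g y = expect (p i) (\<lambda>w. f ((y(i := w))(j := v)) - f (y(i := w)))"
      unfolding g_def using \<open>i \<noteq> j\<close> fin
      by (subst Bochner_Integration.integral_diff) (auto intro: integrable_measure_pmf_finite simp: fun_upd_twist)
    also have "\<bar>\<dots>\<bar> \<le> expect (p i) (\<lambda>w. \<bar>f ((y(i := w))(j := v)) - f (y(i := w))\<bar>)"
      by (rule integral_abs_bound)
    also have "\<dots> \<le> expect (p i) (\<lambda>w. c)"
      using insert.prems(2)[of j] that fin by (intro expect_mono_finite) (auto simp del: fun_upd_apply)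
    finally show ?thesis by simp
  qed
  have "expect (Pi_pmf (insert i I) d p) (\<lambda>x. exp (l * f x)) =
      expect (Pi_pmf I d p) (\<lambda>y. expect (p i) (\<lambda>v. exp (l * f (y(i := v)))))"
    using insert by (subst expect_Pi_pmf_insert) auto
  also have "\<dots> \<le> expect (Pi_pmf I d p) (\<lambda>y. exp (l * g y) * exp (l\<^sup>2 * c\<^sup>2 / 2))"
  proof (rule expect_mono_finite[OF fin(1)])
    fix y
    \<comment> \<open>With the other coordinates fixed, every value lies within \<open>c\<close> of
      \<open>f y\<close>, which becomes the centre.\<close>
    show "expect (p i) (\<lambda>v. exp (l * f (y(i := v)))) \<le> exp (l * g y) * exp (l\<^sup>2 * c\<^sup>2 / 2)"
      unfolding g_def exp_add[symmetric]
      by (rule expect_exp_bounded[where w = "f y"]) (use insert.prems fin in \<open>auto simp del: fun_upd_apply\<close>)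
  qed
  also have "\<dots> \<le> exp (l * expect (Pi_pmf I d p) g + l\<^sup>2 * c\<^sup>2 / 2 * card I) * exp (l\<^sup>2 * c\<^sup>2 / 2)"
    using insert.IH[of g] insert.prems g by (simp del: fun_upd_apply)
  also have "expect (Pi_pmf I d p) g = expect (Pi_pmf (insert i I) d p) f"
    unfolding g_def using insert by (subst expect_Pi_pmf_insert) auto
  finally show ?case
    using insert.hyps by (simp add: exp_add[symmetric] algebra_simps add_divide_distrib)
qed

section \<open>Exponential tail bounds and distinguishing tests\<close>

lemma prob_ge_le_expect_exp:
  assumes "finite (set_pmf p)"
  shows "measure_pmf.prob p {x. t \<le> f x} \<le> exp (- t) * expect p (\<lambda>x. exp (f x))"
proof -
  have "measure_pmf.prob p {x. t \<le> f x} = expect p (indicator {x. t \<le> f x})"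
    by simp
  also have "\<dots> \<le> expect p (\<lambda>x. exp (- t) * exp (f x))"
    by (rule expect_mono_finite[OF assms]) (auto simp: indicator_def exp_add[symmetric])
  finally show ?thesis by simp
qed

text \<open>The advantage on \<open>T\<close> equals the reversed advantage on the complement of
  \<open>T\<close>, so both halves of the sum are at least as large as it. This compensates the
  factor 1/2.\<close>

lemma stat_dist_ge:
  assumes "finite (set_pmf A)" "finite (set_pmf B)"
  shows "stat_dist A B \<ge> measure_pmf.prob A T - measure_pmf.prob B T"
proof -
  define W where "W = set_pmf A \<union> set_pmf B"
  have finW: "finite W" using assms by (simp add: W_def)
  have prob: "measure_pmf.prob p U = (\<Sum>w\<in>W \<inter> U. pmf p w)" if "set_pmf p \<subseteq> W" for p U
  proof -
    have "measure_pmf.prob p U = measure_pmf.prob p (W \<inter> U)"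
      using that by (intro measure_pmf.finite_measure_eq_AE) (auto simp: AE_measure_pmf_iff)
    then show ?thesis using finW by (simp add: measure_measure_pmf_finite)
  qed
  have diff: "measure_pmf.prob A U - measure_pmf.prob B U \<le> (\<Sum>w\<in>W \<inter> U. \<bar>pmf A w - pmf B w\<bar>)"
    "measure_pmf.prob B U - measure_pmf.prob A U \<le> (\<Sum>w\<in>W \<inter> U. \<bar>pmf A w - pmf B w\<bar>)" for U
    by (simp_all add: prob W_def flip: sum_subtractf) (intro sum_mono; simp)+
  have "measure_pmf.prob A T - measure_pmf.prob B T =
      measure_pmf.prob B (- T) - measure_pmf.prob A (- T)"
    using measure_pmf.prob_compl[of T A] measure_pmf.prob_compl[of T B] by (simp add: Compl_eq_Diff_UNIV)
  with diff(1)[of T] diff(2)[of "- T"] have "2 * (measure_pmf.prob A T - measure_pmf.prob B T) \<le>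
      (\<Sum>w\<in>W \<inter> T. \<bar>pmf A w - pmf B w\<bar>) + (\<Sum>w\<in>W \<inter> - T. \<bar>pmf A w - pmf B w\<bar>)"
    by simp
  also have "\<dots> = (\<Sum>w\<in>(W \<inter> T) \<union> (W \<inter> - T). \<bar>pmf A w - pmf B w\<bar>)"
    using finW by (intro sum.union_disjoint[symmetric]) auto
  also have "(W \<inter> T) \<union> (W \<inter> - T) = W" by auto
  finally show ?thesis unfolding stat_dist_def W_def by simp
qed

lemma stat_dist_nonneg: "stat_dist A B \<ge> 0"
  unfolding stat_dist_def by (simp add: sum_nonneg)

subsection \<open>Fourier analysis on the cube\<close>

definition sgn_bit :: "bool \<Rightarrow> real" where
  "sgn_bit b = (if b then -1 else 1)"

definition bxor :: "('i \<Rightarrow> bool) \<Rightarrow> ('i \<Rightarrow> bool) \<Rightarrow> 'i \<Rightarrow> bool" where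
  "bxor x y = (\<lambda>i. x i \<noteq> y i)"

definition chi :: "'i set \<Rightarrow> ('i \<Rightarrow> bool) \<Rightarrow> real" where
  "chi S x = (\<Prod>i\<in>S. sgn_bit (x i))"

text \<open>Points are total functions with default value \<open>False\<close> off \<open>I\<close>,
  as in the product law; this makes the set finite and each point unique.\<close>

definition cube :: "'i set \<Rightarrow> ('i \<Rightarrow> bool) set" where
  "cube I = PiE_dflt I False (\<lambda>_. UNIV)"

definition unif_cube :: "'i set \<Rightarrow> ('i \<Rightarrow> bool) pmf" where
  "unif_cube I = Pi_pmf I False (\<lambda>_. pmf_of_set UNIV)"

lemma mem_cube: "x \<in> cube I \<longleftrightarrow> (\<forall>i. i \<notin> I \<longrightarrow> \<not> x i)"
  by (auto simp: cube_def PiE_dflt_def)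

lemma finite_cube: "finite I \<Longrightarrow> finite (cube I)"
  unfolding cube_def by (rule finite_PiE_dflt) auto

lemma cube_nonempty: "cube I \<noteq> {}"
  unfolding cube_def by simp

lemma card_cube: "finite I \<Longrightarrow> card (cube I) = 2 ^ card I"
  unfolding cube_def by (subst card_PiE_dflt) auto

lemma unif_cube_eq: "finite I \<Longrightarrow> unif_cube I = pmf_of_set (cube I)"
  unfolding unif_cube_def cube_def by (subst Pi_pmf_of_set) auto

lemma set_unif_cube: "finite I \<Longrightarrow> set_pmf (unif_cube I) = cube I"
  by (simp add: unif_cube_eq finite_cube cube_nonempty)

lemma finite_set_unif_cube: "finite I \<Longrightarrow> finite (set_pmf (unif_cube I))"
  by (simp add: set_unif_cube finite_cube)

lemma expect_unif_cube:
  assumes "finite I"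
  shows "expect (unif_cube I) f = (\<Sum>x\<in>cube I. f x) / 2 ^ card I"
  using assms by (simp add: unif_cube_eq integral_pmf_of_set finite_cube cube_nonempty card_cube)

lemma map_bxor_unif_cube:
  assumes "finite I" "e \<in> cube I"
  shows "map_pmf (\<lambda>x. bxor x e) (unif_cube I) = unif_cube I"
proof -
  have "bij_betw (\<lambda>x. bxor x e) (cube I) (cube I)"
    by (rule bij_betw_byWitness[where f' = "\<lambda>x. bxor x e"])
      (use assms in \<open>auto simp: bxor_def mem_cube\<close>)
  then show ?thesis
    using assms by (simp add: unif_cube_eq map_pmf_of_set_bij_betw finite_cube cube_nonempty)
qed

lemma chi_bxor: "chi S (bxor x y) = chi S x * chi S y"
  unfolding chi_def bxor_def prod.distrib[symmetric] by (rule prod.cong) (auto simp: sgn_bit_def)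

lemma sum_chi:
  assumes "finite I"
  shows "(\<Sum>S\<in>Pow I. chi S z) = (if \<exists>i\<in>I. z i then 0 else 2 ^ card I)"
proof -
  have "(\<Sum>S\<in>Pow I. chi S z) = (\<Prod>i\<in>I. sgn_bit (z i) + 1)"
    unfolding chi_def by (subst prod_add[OF assms]) simp
  also have "\<dots> = (if \<exists>i\<in>I. z i then 0 else 2 ^ card I)"
    using assms by (auto simp: sgn_bit_def)
  finally show ?thesis .
qed

section \<open>Fourier coefficients, shifts and Parseval's identity\<close>

definition fourier :: "'i set \<Rightarrow> (('i \<Rightarrow> bool) \<Rightarrow> real) \<Rightarrow> 'i set \<Rightarrow> real" where
  "fourier I f S = expect (unif_cube I) (\<lambda>x. f x * chi S x)"

text \<open>Expand the squares into a double sum over \<open>x\<close> and \<open>y\<close>. Summing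
  the characters over all \<open>S\<close> first leaves only the terms with
  \<open>y = bxor x e\<close>.\<close>

lemma expect_shift_eq_fourier:
  assumes I: "finite I" and e: "e \<in> cube I"
  shows "expect (unif_cube I) (\<lambda>x. f x * f (bxor x e)) = (\<Sum>S\<in>Pow I. (fourier I f S)\<^sup>2 * chi S e)"
proof -
  define K :: real where "K = 2 ^ card I"
  have "(\<Sum>S\<in>Pow I. (fourier I f S)\<^sup>2 * chi S e) =
      (\<Sum>S\<in>Pow I. (\<Sum>x\<in>cube I. \<Sum>y\<in>cube I. f x * f y * chi S (bxor x (bxor y e)))) / K\<^sup>2"
    unfolding fourier_def expect_unif_cube[OF I] K_def sum_divide_distrib chi_bxor
    by (simp add: power2_eq_square sum_product sum_distrib_left sum_distrib_right sum_divide_distrib mult_ac)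
  also have "\<dots> = (\<Sum>x\<in>cube I. \<Sum>y\<in>cube I. f x * f y * (\<Sum>S\<in>Pow I. chi S (bxor x (bxor y e)))) / K\<^sup>2"
    by (subst sum.swap, subst sum.swap) (simp add: sum_distrib_left)
  also have "\<dots> = (\<Sum>x\<in>cube I. \<Sum>y\<in>cube I. if y = bxor x e then f x * f y * K else 0) / K\<^sup>2"
  proof -
    have "(\<Sum>S\<in>Pow I. chi S (bxor x (bxor y e))) = (if y = bxor x e then K else 0)"
      if "x \<in> cube I" "y \<in> cube I" for x y
    proof -
      have "(\<exists>i\<in>I. bxor x (bxor y e) i) \<longleftrightarrow> y \<noteq> bxor x e"
        using that e by (auto simp: mem_cube bxor_def fun_eq_iff)
      then show ?thesis using I by (simp add: sum_chi K_def)
    qed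
    then show ?thesis by (intro arg_cong[where f = "\<lambda>t. t / K\<^sup>2"] sum.cong) auto
  qed
  also have "\<dots> = (\<Sum>x\<in>cube I. f x * f (bxor x e) * K) / K\<^sup>2"
  proof -
    have "bxor x e \<in> cube I" if "x \<in> cube I" for x
      using that e by (auto simp: mem_cube bxor_def)
    then show ?thesis using I by (simp add: finite_cube)
  qed
  also have "\<dots> = (\<Sum>x\<in>cube I. f x * f (bxor x e)) / K"
    by (simp add: sum_distrib_right[symmetric] power2_eq_square K_def)
  finally show ?thesis using I by (simp add: expect_unif_cube K_def)
qed

text \<open>Parseval's identity, obtained from the zero shift.\<close>

lemma sum_fourier_squared:
  assumes "finite I" "\<And>x. f x * f x = 1"
  shows "(\<Sum>S\<in>Pow I. (fourier I f S)\<^sup>2) = 1"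
proof -
  have "chi S (\<lambda>_. False) = 1" for S :: "'a set" by (simp add: chi_def sgn_bit_def)
  then have "(\<Sum>S\<in>Pow I. (fourier I f S)\<^sup>2) =
      expect (unif_cube I) (\<lambda>x. f x * f (bxor x (\<lambda>_. False)))"
    using assms(1) by (subst expect_shift_eq_fourier) (auto simp: mem_cube)
  also have "\<dots> = expect (unif_cube I) (\<lambda>x. 1)"
    using assms(2) by (simp add: bxor_def)
  finally show ?thesis by simp
qed

text \<open>Flipping bit \<open>i\<close> preserves the uniform law and \<open>f\<close> but negates
  \<open>chi S\<close>, so the coefficient is its own negative.\<close>

lemma fourier_eq_0:
  assumes "finite I" "i \<in> S" "S \<subseteq> I" and f: "\<And>x. f (x(i := \<not> x i)) = f x"
  shows "fourier I f S = 0"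
proof -
  define e where "e = (\<lambda>j. j = i)"
  have e: "e \<in> cube I" using assms by (auto simp: mem_cube e_def)
  have "finite S" using assms finite_subset by blast
  then have "chi S e = -1"
    using assms(2) unfolding chi_def e_def sgn_bit_def by (simp add: prod.If_cases Int_absorb1 Collect_conv_if)
  have f': "f (bxor x e) = f x" for x
  proof -
    have "bxor x e = x(i := \<not> x i)" by (auto simp: bxor_def e_def)
    then show ?thesis using f[of x] by simp
  qed
  have "fourier I f S = expect (map_pmf (\<lambda>x. bxor x e) (unif_cube I)) (\<lambda>x. f x * chi S x)"
    unfolding fourier_def map_bxor_unif_cube[OF assms(1) e] ..
  also have "\<dots> = - fourier I f S"
    by (simp add: fourier_def chi_bxor \<open>chi S e = -1\<close> f')
  finally show ?thesis by simp
qed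

subsection \<open>Block noise and noise stability\<close>

text \<open>
  In block \<open>b\<close> the noise flips bit number \<open>u b - 1\<close>, and nothing if \<open>u b = 0\<close>; positions beyond the last
  block are never flipped because \<open>u\<close> vanishes there.
\<close>

definition noise :: "nat \<Rightarrow> (nat \<Rightarrow> nat) \<Rightarrow> nat \<Rightarrow> bool" where
  "noise B u = (\<lambda>i. u (i div B) = Suc (i mod B))"

definition restr :: "'i set \<Rightarrow> ('i \<Rightarrow> bool) \<Rightarrow> 'i \<Rightarrow> bool" where
  "restr L e = (\<lambda>i. i \<in> L \<and> e i)"

definition block_law :: "nat \<Rightarrow> bool \<Rightarrow> nat pmf" where
  "block_law k a = (if a then pmf_of_set {..<2 ^ k} else return_pmf 0)"

text \<open>The law of a block after averaging over its activity. The density 3/8 exceeds the 1/4 of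
  active blocks that the min-entropy needs, and twice the density is the slope in
  \<open>four_powr_le\<close>.\<close>

definition mixed_block_law :: "nat \<Rightarrow> nat pmf" where
  "mixed_block_law k = bind_pmf (bernoulli_pmf (3/8)) (block_law k)"

lemma finite_set_block_law: "finite (set_pmf (block_law k a))"
  by (simp add: block_law_def lessThan_empty_iff)

lemma finite_set_mixed_block_law: "finite (set_pmf (mixed_block_law k))"
  by (auto simp: mixed_block_law_def finite_set_block_law intro: finite_subset[OF subset_UNIV])

lemma expect_mixed_block_law:
  "expect (mixed_block_law k) q = 5/8 * q 0 + 3/8 * ((\<Sum>w<2 ^ k. q w) / 2 ^ k)"
proof -
  have "expect (mixed_block_law k) q = expect (bernoulli_pmf (3/8)) (\<lambda>a. expect (block_law k a) q)"
    unfolding mixed_block_law_def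
    by (rule expect_bind_finite) (auto simp: finite_set_block_law intro: finite_subset[OF subset_UNIV])
  then show ?thesis
    by (simp add: block_law_def integral_pmf_of_set lessThan_empty_iff)
qed

text \<open>The right side is the chord over [0, 1] of a convex function.\<close>

lemma four_powr_le:
  assumes "0 \<le> x" "x \<le> (1::real)"
  shows "4 powr (- x) \<le> 1 - 3/4 * x"
proof -
  have "exp ((1 - x) *\<^sub>R 0 + x *\<^sub>R (- ln 4)) \<le> (1 - x) * exp 0 + x * exp (- ln (4::real))"
    by (rule convex_onD[OF exp_convex]) (use assms in auto)
  then show ?thesis
    by (simp add: powr_def exp_minus algebra_simps)
qed

text \<open>The character changes sign exactly when the flipped bit lies in \<open>S\<close>, so its
  mean is \<open>1 - 3/4 * (card S / 2 ^ k)\<close>. The exponential form of the bound is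
  multiplicative over blocks.\<close>

lemma expect_chi_block:
  assumes S: "\<And>i. i \<in> S \<Longrightarrow> i div B = b" and B: "B = 2 ^ k - 1" "k \<ge> 1" and fin: "finite S"
  shows "expect (mixed_block_law k) (\<lambda>w. \<Prod>i\<in>S. sgn_bit (w = Suc (i mod B))) \<ge>
    4 powr (- real (card S) / 2 ^ k)"
proof -
  define W where "W = (\<lambda>i. Suc (i mod B)) ` S"
  have k2: "(2::nat) ^ k \<ge> 2" using B(2) by (metis power_increasing power_one_right one_le_numeral)
  then have "B > 0" using B by simp
  have inj: "inj_on (\<lambda>i. Suc (i mod B)) S"
    by (rule inj_onI) (metis S div_mult_mod_eq nat.inject)
  then have cardW: "card W = card S" by (simp add: W_def card_image)
  have W: "W \<subseteq> {..<2 ^ k}" "0 \<notin> W"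
  proof -
    have "Suc (i mod B) < 2 ^ k" for i
      using mod_less_divisor[OF \<open>B > 0\<close>, of i] B(1) k2 by linarith
    then show "W \<subseteq> {..<2 ^ k}" "0 \<notin> W" by (auto simp: W_def)
  qed
  \<comment> \<open>A symbol \<open>w\<close> names at most one bit of the block, so at most one
    factor is \<open>-1\<close>; the symbol 0 names none.\<close>
  have q: "(\<Prod>i\<in>S. sgn_bit (w = Suc (i mod B))) = 1 - 2 * indicator W w" for w
  proof (cases "w \<in> W")
    case True
    then obtain i where i: "i \<in> S" "w = Suc (i mod B)" by (auto simp: W_def)
    have "(\<Prod>j\<in>S. sgn_bit (w = Suc (j mod B))) =
        sgn_bit (w = Suc (i mod B)) * (\<Prod>j\<in>S - {i}. sgn_bit (w = Suc (j mod B)))"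
      using fin i by (intro prod.remove)
    also have "(\<Prod>j\<in>S - {i}. sgn_bit (w = Suc (j mod B))) = 1"
      using i inj by (intro prod.neutral) (auto simp: sgn_bit_def inj_on_def)
    finally show ?thesis using True i by (simp add: sgn_bit_def)
  next
    case False
    then have "(\<Prod>j\<in>S. sgn_bit (w = Suc (j mod B))) = 1"
      by (intro prod.neutral) (auto simp: sgn_bit_def W_def)
    with False show ?thesis by simp
  qed
  have "(\<Sum>w<2 ^ k. indicator W w) = real (card S)"
    using W(1) cardW by (simp add: indicator_def Int_absorb1 flip: sum.inter_filter)
  then have "(\<Sum>w<2 ^ k. 1 - 2 * indicator W w :: real) = 2 ^ k - 2 * real (card S)"
    by (simp add: sum_subtractf flip: sum_distrib_left)
  then have "expect (mixed_block_law k) (\<lambda>w. \<Prod>i\<in>S. sgn_bit (w = Suc (i mod B))) =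
      1 - 3/4 * (real (card S) / 2 ^ k)"
    unfolding q expect_mixed_block_law using W(2) by (simp add: diff_divide_distrib)
  moreover have "card S \<le> 2 ^ k"
    using card_mono[OF _ W(1)] cardW by simp
  then have "real (card S) / 2 ^ k \<le> 1"
    by (simp add: divide_le_eq)
  ultimately show ?thesis
    using four_powr_le[of "real (card S) / 2 ^ k"] by simp
qed

text \<open>Blocks are independent, so the expectation factors and the exponents add up. Positions
  of \<open>S\<close> past the last block are never flipped and only help.\<close>

lemma expect_chi_noise:
  assumes B: "B = 2 ^ k - 1" "k \<ge> 1" and fin: "finite S"
  shows "expect (Pi_pmf {..<N} 0 (\<lambda>_. mixed_block_law k)) (\<lambda>u. chi S (noise B u)) \<ge>
    4 powr (- real (card S) / 2 ^ k)"
proof -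
  let ?P = "Pi_pmf {..<N} 0 (\<lambda>_. mixed_block_law k)"
  define C where "C b = {i \<in> {i \<in> S. i div B < N}. i div B = b}" for b
  have finC: "finite (C b)" for b using fin by (simp add: C_def)
  have chi: "chi S (noise B u) = (\<Prod>b<N. \<Prod>i\<in>C b. sgn_bit (u b = Suc (i mod B)))"
    if "u \<in> set_pmf ?P" for u
  proof -
    have u: "u b = 0" if "\<not> b < N" for b
      using \<open>u \<in> set_pmf ?P\<close> set_Pi_pmf_subset[of "{..<N}" 0] that by fastforce
    have "chi S (noise B u) = (\<Prod>i\<in>{i \<in> S. i div B < N}. sgn_bit (u (i div B) = Suc (i mod B)))"
      unfolding chi_def noise_def
      using fin u by (intro prod.mono_neutral_right) (auto simp: sgn_bit_def)
    also have "\<dots> = (\<Prod>b<N. \<Prod>i\<in>C b. sgn_bit (u (i div B) = Suc (i mod B)))"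
      unfolding C_def using fin by (intro prod.group[symmetric]) auto
    finally show ?thesis by (simp add: C_def)
  qed
  have "4 powr (- real (card S) / 2 ^ k) \<le> 4 powr (- real (\<Sum>b<N. card (C b)) / 2 ^ k)"
  proof -
    have "(\<Sum>b<N. card (C b)) = card {i \<in> S. i div B < N}"
      unfolding C_def card_eq_sum using fin by (intro sum.group) auto
    also have "\<dots> \<le> card S" using fin by (intro card_mono) auto
    finally show ?thesis by (intro powr_mono divide_right_mono) (auto simp flip: of_nat_sum)
  qed
  also have "\<dots> = 4 powr (\<Sum>b<N. - real (card (C b)) / 2 ^ k)"
    by (simp add: sum_negf sum_divide_distrib[symmetric])
  also have "\<dots> = (\<Prod>b<N. 4 powr (- real (card (C b)) / 2 ^ k))"
    by (simp add: powr_sum)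
  also have "\<dots> \<le> (\<Prod>b<N. expect (mixed_block_law k) (\<lambda>w. \<Prod>i\<in>C b. sgn_bit (w = Suc (i mod B))))"
    by (intro prod_mono conjI powr_ge_zero expect_chi_block[OF _ B finC]) (auto simp: C_def)
  also have "\<dots> = expect ?P (\<lambda>u. \<Prod>b<N. \<Prod>i\<in>C b. sgn_bit (u b = Suc (i mod B)))"
    by (rule expect_prod_Pi_pmf[symmetric]) (auto simp: finite_set_mixed_block_law)
  also have "\<dots> = expect ?P (\<lambda>u. chi S (noise B u))"
    by (intro integral_cong_AE) (auto simp: AE_measure_pmf_iff chi)
  finally show ?thesis .
qed

text \<open>By \<open>expect_shift_eq_fourier\<close> the left side averages character expectations
  with the squared Fourier coefficients as weights. These sum to 1 and vanish unless
  \<open>S \<subseteq> V\<close>, where the expectation is at least the bound for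
  \<open>card V\<close>. Restricting the noise to \<open>L\<close> alters no character of a subset
  of \<open>L\<close>.\<close>

lemma noise_stability:
  assumes B: "B = 2 ^ k - 1" "k \<ge> 1" and L: "finite L" and V: "finite V"
    and sq: "\<And>x. f x * f x = 1" and irr: "\<And>i x v. i \<notin> V \<Longrightarrow> f (x(i := v)) = f x"
  shows "expect (Pi_pmf {..<N} 0 (\<lambda>_. mixed_block_law k))
      (\<lambda>u. expect (unif_cube L) (\<lambda>y. f y * f (bxor y (restr L (noise B u))))) \<ge>
    4 powr (- real (card V) / 2 ^ k)"
proof -
  let ?P = "Pi_pmf {..<N} 0 (\<lambda>_. mixed_block_law k)"
  have finP: "finite (set_pmf ?P)"
    by (intro finite_set_Pi_pmf) (auto simp: finite_set_mixed_block_law)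
  have "4 powr (- real (card V) / 2 ^ k) = (\<Sum>S\<in>Pow L. (fourier L f S)\<^sup>2 * 4 powr (- real (card V) / 2 ^ k))"
    using sum_fourier_squared[OF L sq] by (simp add: sum_distrib_right[symmetric])
  also have "\<dots> \<le> (\<Sum>S\<in>Pow L. (fourier L f S)\<^sup>2 * expect ?P (\<lambda>u. chi S (noise B u)))"
  proof (rule sum_mono)
    fix S assume S: "S \<in> Pow L"
    show "(fourier L f S)\<^sup>2 * 4 powr (- real (card V) / 2 ^ k) \<le>
        (fourier L f S)\<^sup>2 * expect ?P (\<lambda>u. chi S (noise B u))"
    proof (cases "S \<subseteq> V")
      case True
      then have "4 powr (- real (card V) / 2 ^ k) \<le> 4 powr (- real (card S) / 2 ^ k)"
        using V by (intro powr_mono divide_right_mono) (auto intro: card_mono)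
      also have "\<dots> \<le> expect ?P (\<lambda>u. chi S (noise B u))"
        using S L by (intro expect_chi_noise[OF B]) (auto intro: finite_subset)
      finally show ?thesis by (intro mult_left_mono) auto
    next
      case False
      then obtain i where "i \<in> S" "i \<notin> V" by auto
      then have "fourier L f S = 0"
        using S irr by (intro fourier_eq_0[OF L, of i]) auto
      then show ?thesis by simp
    qed
  qed
  also have "\<dots> = expect ?P (\<lambda>u. \<Sum>S\<in>Pow L. (fourier L f S)\<^sup>2 * chi S (noise B u))"
    by (simp add: integrable_measure_pmf_finite[OF finP])
  also have "\<dots> = expect ?P (\<lambda>u. expect (unif_cube L) (\<lambda>y. f y * f (bxor y (restr L (noise B u)))))"
  proof -
    have "(\<Sum>S\<in>Pow L. (fourier L f S)\<^sup>2 * chi S (noise B u)) =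
        expect (unif_cube L) (\<lambda>y. f y * f (bxor y (restr L (noise B u))))" for u
    proof -
      have "chi S (restr L (noise B u)) = chi S (noise B u)" if "S \<in> Pow L" for S
        unfolding chi_def restr_def using that by (intro prod.cong) auto
      then show ?thesis
        using L by (subst expect_shift_eq_fourier) (auto simp: mem_cube restr_def)
    qed
    then show ?thesis by simp
  qed
  finally show ?thesis .
qed

subsection \<open>Dependencies of sparse functions\<close>

definition out :: "nat \<Rightarrow> (bool list \<Rightarrow> bool list) \<Rightarrow> nat \<Rightarrow> (nat \<Rightarrow> bool) \<Rightarrow> real" where
  "out n h j x = sgn_bit (h (map x [0..<n]) ! j)"

definition inputs_of :: "nat \<Rightarrow> (bool list \<Rightarrow> bool list) \<Rightarrow> nat \<Rightarrow> nat set" where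
  "inputs_of n h j = {i. i < n \<and> depends_on n h i j}"

definition outputs_of :: "nat \<Rightarrow> nat \<Rightarrow> (bool list \<Rightarrow> bool list) \<Rightarrow> nat \<Rightarrow> nat set" where
  "outputs_of n m h i = {j. j < m \<and> i < n \<and> depends_on n h i j}"

text \<open>This is \<open>m\<close> minus twice the Hamming distance between the first
  \<open>m\<close> bits of the two outputs.\<close>

definition corr :: "nat \<Rightarrow> nat \<Rightarrow> (bool list \<Rightarrow> bool list) \<Rightarrow> (nat \<Rightarrow> bool) \<Rightarrow> (nat \<Rightarrow> bool) \<Rightarrow> real" where
  "corr n m h x z = (\<Sum>j<m. out n h j x * out n h j z)"

definition glue :: "'i set \<Rightarrow> ('i \<Rightarrow> 'a) \<Rightarrow> ('i \<Rightarrow> 'a) \<Rightarrow> 'i \<Rightarrow> 'a" where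
  "glue L y w = (\<lambda>i. if i \<in> L then y i else w i)"

lemma finite_inputs_of: "finite (inputs_of n h j)"
  by (simp add: inputs_of_def)

lemma finite_outputs_of: "finite (outputs_of n m h i)"
  by (simp add: outputs_of_def)

lemma sparsity_eq_sum_inputs: "sparsity n m h = (\<Sum>j<m. card (inputs_of n h j))"
proof -
  have "bij_betw (\<lambda>(j, i). (i, j)) (SIGMA j:{..<m}. inputs_of n h j)
      {(i, j). i < n \<and> j < m \<and> depends_on n h i j}"
    by (rule bij_betw_byWitness[where f' = "\<lambda>(i, j). (j, i)"]) (auto simp: inputs_of_def)
  from bij_betw_same_card[OF this] show ?thesis
    by (simp add: sparsity_def finite_inputs_of)
qed

lemma sparsity_eq_sum_outputs: "sparsity n m h = (\<Sum>i<n. card (outputs_of n m h i))"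
proof -
  have "{(i, j). i < n \<and> j < m \<and> depends_on n h i j} = (SIGMA i:{..<n}. outputs_of n m h i)"
    by (auto simp: outputs_of_def)
  then show ?thesis by (simp add: sparsity_def finite_outputs_of)
qed

lemma abs_out: "\<bar>out n h j x\<bar> = 1" and out_sq: "out n h j x * out n h j x = 1"
  by (auto simp: out_def sgn_bit_def)

text \<open>\<open>depends_on\<close> compares all positions, also those past the end of the lists.
  There \<open>xs ! k\<close> equals \<open>[] ! (k - length xs)\<close>, which is unspecified but
  the same for lists of equal length.\<close>

lemma nth_beyond_eq:
  assumes "length xs = length ys" "length xs \<le> k"
  shows "xs ! k = ys ! k"
  using nth_append[of xs "[]" k] nth_append[of ys "[]" k] assms by simp

lemma out_upd:
  assumes "i \<notin> inputs_of n h j"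
  shows "out n h j (x(i := v)) = out n h j x"
proof (cases "i < n")
  case True
  with assms have nd: "\<not> depends_on n h i j" by (simp add: inputs_of_def)
  have "map (x(i := v)) [0..<n] ! k = map x [0..<n] ! k" if "k \<noteq> i" for k
  proof (cases "k < n")
    case False
    then show ?thesis by (intro nth_beyond_eq) auto
  qed (use that in auto)
  then have "depends_on n h i j" if "h (map (x(i := v)) [0..<n]) ! j \<noteq> h (map x [0..<n]) ! j"
    unfolding depends_on_def bitstrings_def
    using that by (intro exI[of _ "map (x(i := v)) [0..<n]"] exI[of _ "map x [0..<n]"]) auto
  with nd have "h (map (x(i := v)) [0..<n]) ! j = h (map x [0..<n]) ! j" by blast
  then show ?thesis by (simp add: out_def)
next
  case False
  then have "map (x(i := v)) [0..<n] = map x [0..<n]" by auto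
  then show ?thesis by (simp only: out_def)
qed

text \<open>Only outputs depending on \<open>i\<close> contribute, each at most 2. Both points
  change together because altering an input bit alters it in both members of a noisy pair.\<close>

lemma corr_upd:
  "\<bar>corr n m h (x(i := v)) (z(i := w)) - corr n m h x z\<bar> \<le> 2 * real (card (outputs_of n m h i))"
proof -
  let ?d = "\<lambda>j. out n h j (x(i := v)) * out n h j (z(i := w)) - out n h j x * out n h j z"
  have "\<bar>corr n m h (x(i := v)) (z(i := w)) - corr n m h x z\<bar> = \<bar>\<Sum>j<m. ?d j\<bar>"
    by (simp add: corr_def sum_subtractf)
  also have "\<dots> \<le> (\<Sum>j<m. \<bar>?d j\<bar>)" by (rule sum_abs)
  also have "\<dots> = (\<Sum>j\<in>outputs_of n m h i. \<bar>?d j\<bar>)"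
  proof (rule sum.mono_neutral_right)
    show "\<forall>j\<in>{..<m} - outputs_of n m h i. \<bar>?d j\<bar> = 0"
    proof
      fix j assume "j \<in> {..<m} - outputs_of n m h i"
      then have "i \<notin> inputs_of n h j" by (auto simp: inputs_of_def outputs_of_def)
      then show "\<bar>?d j\<bar> = 0" by (simp add: out_upd del: fun_upd_apply)
    qed
  qed (auto simp: outputs_of_def)
  also have "\<dots> \<le> (\<Sum>j\<in>outputs_of n m h i. 2)"
  proof (rule sum_mono)
    fix j
    show "\<bar>?d j\<bar> \<le> 2"
      using abs_triangle_ineq4[of "out n h j (x(i := v)) * out n h j (z(i := w))" "out n h j x * out n h j z"]
      by (simp add: abs_mult abs_out del: fun_upd_apply)
  qed
  finally show ?thesis by simp
qed

text \<open>A new symbol in block \<open>b\<close> affects only the position flipped before and the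
  one flipped now.\<close>

lemma noise_upd:
  obtains p q c c' where "noise B (u(b := v)) = (noise B u)(p := c, q := c')"
proof -
  \<comment> \<open>For the symbol 0 the truncated subtraction selects the first bit of the block.
    This is harmless, since \<open>c\<close> and \<open>c'\<close> are just the new values at
    \<open>p\<close> and \<open>q\<close>.\<close>
  define p q where "p = b * B + (u b - 1)" and "q = b * B + (v - 1)"
  have "noise B (u(b := v)) i = noise B u i" if "i \<noteq> p" "i \<noteq> q" for i
  proof (cases "i div B = b")
    case True
    then have "i = b * B + i mod B" by (metis div_mult_mod_eq)
    with that have "i mod B \<noteq> u b - 1" "i mod B \<noteq> v - 1" by (auto simp: p_def q_def)
    with True show ?thesis by (auto simp: noise_def)
  next
    case False
    then show ?thesis by (simp add: noise_def)
  qed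
  then have "noise B (u(b := v)) =
      (noise B u)(p := noise B (u(b := v)) p, q := noise B (u(b := v)) q)"
    by (auto simp: fun_eq_iff)
  then show ?thesis by (rule that)
qed

lemma corr_restr_upd:
  assumes "\<And>i. i \<in> L \<Longrightarrow> real (card (outputs_of n m h i)) \<le> d" "d \<ge> 0"
  shows "\<bar>corr n m h x (bxor x (restr L (e(p := c)))) - corr n m h x (bxor x (restr L e))\<bar> \<le> 2 * d"
proof (cases "p \<in> L")
  case True
  have "bxor x (restr L (e(p := c))) = (bxor x (restr L e))(p := (x p \<noteq> c))"
    using True by (auto simp: bxor_def restr_def fun_eq_iff)
  moreover have "x = x(p := x p)" by simp
  ultimately have "\<bar>corr n m h x (bxor x (restr L (e(p := c)))) - corr n m h x (bxor x (restr L e))\<bar> \<le>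
      2 * real (card (outputs_of n m h p))"
    using corr_upd by metis
  also have "\<dots> \<le> 2 * d" using assms(1)[OF True] by simp
  finally show ?thesis .
next
  case False
  then have "restr L (e(p := c)) = restr L e" by (auto simp: restr_def fun_eq_iff)
  then show ?thesis using assms(2) by simp
qed

text \<open>Two noise bits change, at a cost of \<open>2 * d\<close> each.\<close>

lemma corr_noise_upd:
  assumes "\<And>i. i \<in> L \<Longrightarrow> real (card (outputs_of n m h i)) \<le> d" "d \<ge> 0"
  shows "\<bar>corr n m h x (bxor x (restr L (noise B (u(b := v))))) - corr n m h x (bxor x (restr L (noise B u)))\<bar> \<le> 4 * d"
proof -
  obtain p q c c' where eq: "noise B (u(b := v)) = (noise B u)(p := c, q := c')"
    by (rule noise_upd)
  show ?thesis
    unfolding eq using corr_restr_upd[OF assms, where L = L and x = x and e = "(noise B u)(p := c)" and p = q and c = c']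
      corr_restr_upd[OF assms, where L = L and x = x and e = "noise B u" and p = p and c = c] by linarith
qed

text \<open>
  The inputs outside \<open>L\<close> are frozen to \<open>w\<close>. Bounded differences are applied first to the inputs in
  \<open>L\<close> and then to the noise.
\<close>

lemma expect_exp_corr_fixed:
  assumes B: "B = 2 ^ k - 1" "k \<ge> 1" and L: "L \<subseteq> {..<n}" and N: "N \<le> n"
    and d: "\<And>i. i \<in> L \<Longrightarrow> real (card (outputs_of n m h i)) \<le> d" "d \<ge> 0" and l: "l > 0"
  defines "F \<equiv> \<lambda>x u. corr n m h x (bxor x (restr L (noise B u)))"
  shows "expect (Pi_pmf {..<N} 0 (\<lambda>_. mixed_block_law k))
      (\<lambda>u. expect (unif_cube L) (\<lambda>y. exp (- l * F (glue L y w) u))) \<le>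
    exp (- l * (\<Sum>j<m. 4 powr (- real (card (inputs_of n h j)) / 2 ^ k)) + 10 * l\<^sup>2 * d\<^sup>2 * n)"
proof -
  let ?P = "Pi_pmf {..<N} 0 (\<lambda>_. mixed_block_law k)"
  define \<mu> where "\<mu> = (\<Sum>j<m. 4 powr (- real (card (inputs_of n h j)) / 2 ^ k))"
  define G where "G u = expect (unif_cube L) (\<lambda>y. F (glue L y w) u)" for u
  have finL: "finite L" using L finite_subset by blast
  have finP: "finite (set_pmf ?P)"
    by (intro finite_set_Pi_pmf) (auto simp: finite_set_mixed_block_law)
  have F_upd: "\<bar>- F (glue L (y(i := v)) w) u - - F (glue L y w) u\<bar> \<le> 2 * d" if "i \<in> L" for y i v u
  proof -
    have "glue L (y(i := v)) w = (glue L y w)(i := v)"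
      using that by (auto simp: glue_def fun_eq_iff)
    moreover have "bxor (x(i := v)) e = (bxor x e)(i := (v \<noteq> e i))" for x e
      by (auto simp: bxor_def fun_eq_iff)
    ultimately have "\<bar>F (glue L (y(i := v)) w) u - F (glue L y w) u\<bar> \<le> 2 * real (card (outputs_of n m h i))"
      unfolding F_def using corr_upd by metis
    with d(1)[OF that] show ?thesis by (simp add: abs_minus_commute)
  qed
  have inner: "expect (unif_cube L) (\<lambda>y. exp (- l * F (glue L y w) u)) \<le>
      exp (l * (- G u)) * exp (2 * l\<^sup>2 * d\<^sup>2 * n)" for u
  proof -
    have "expect (unif_cube L) (\<lambda>y. exp (l * (- F (glue L y w) u))) \<le>
        exp (l * expect (unif_cube L) (\<lambda>y. - F (glue L y w) u) + l\<^sup>2 * (2 * d)\<^sup>2 / 2 * card L)"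
      unfolding unif_cube_def
      by (rule expect_exp_bounded_differences[where f = "\<lambda>y. - F (glue L y w) u", OF finL _ F_upd l]) auto
    also have "\<dots> \<le> exp (l * (- G u) + l\<^sup>2 * (2 * d)\<^sup>2 / 2 * n)"
      using card_mono[OF _ L] by (auto simp: G_def intro!: mult_left_mono)
    finally show ?thesis by (simp add: exp_add[symmetric] power_mult_distrib mult_ac)
  qed
  have G_upd: "\<bar>- G (u(b := v)) - - G u\<bar> \<le> 4 * d" for u b v
  proof -
    have "\<bar>G (u(b := v)) - G u\<bar> =
        \<bar>expect (unif_cube L) (\<lambda>y. F (glue L y w) (u(b := v)) - F (glue L y w) u)\<bar>"
      unfolding G_def using finL
      by (subst Bochner_Integration.integral_diff) (auto intro: integrable_measure_pmf_finite finite_set_unif_cube)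
    also have "\<dots> \<le> expect (unif_cube L) (\<lambda>y. \<bar>F (glue L y w) (u(b := v)) - F (glue L y w) u\<bar>)"
      by (rule integral_abs_bound)
    also have "\<dots> \<le> expect (unif_cube L) (\<lambda>y. 4 * d)"
      unfolding F_def by (intro expect_mono_finite finite_set_unif_cube finL corr_noise_upd d)
    finally show ?thesis by (simp add: abs_minus_commute)
  qed
  \<comment> \<open>With the inputs outside \<open>L\<close> frozen to \<open>w\<close>, each output
    is still a sign function that ignores everything outside \<open>inputs_of n h j\<close>, so
    noise stability applies for every \<open>w\<close>.\<close>
  have mean: "\<mu> \<le> expect ?P G"
  proof -
    have "\<mu> \<le> (\<Sum>j<m. expect ?P (\<lambda>u. expect (unif_cube L) (\<lambda>y. out n h j (glue L y w) *
        out n h j (glue L (bxor y (restr L (noise B u))) w))))"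
      unfolding \<mu>_def
    proof (rule sum_mono, rule noise_stability[OF B finL finite_inputs_of])
      fix i j :: nat and x :: "nat \<Rightarrow> bool" and v :: bool assume "i \<notin> inputs_of n h j"
      then show "out n h j (glue L (x(i := v)) w) = out n h j (glue L x w)"
      proof (cases "i \<in> L")
        case True
        then have "glue L (x(i := v)) w = (glue L x w)(i := v)" by (auto simp: glue_def fun_eq_iff)
        then show ?thesis using out_upd[OF \<open>i \<notin> inputs_of n h j\<close>] by simp
      next
        case False
        then have "glue L (x(i := v)) w = glue L x w" by (auto simp: glue_def fun_eq_iff)
        then show ?thesis by simp
      qed
    qed (rule out_sq)
    also have "\<dots> = expect ?P (\<lambda>u. \<Sum>j<m. expect (unif_cube L) (\<lambda>y. out n h j (glue L y w) *
        out n h j (glue L (bxor y (restr L (noise B u))) w)))"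
      by (rule Bochner_Integration.integral_sum[symmetric]) (rule integrable_measure_pmf_finite[OF finP])
    also have "\<dots> = expect ?P (\<lambda>u. expect (unif_cube L) (\<lambda>y. \<Sum>j<m. out n h j (glue L y w) *
        out n h j (glue L (bxor y (restr L (noise B u))) w)))"
      by (subst Bochner_Integration.integral_sum) (auto intro: integrable_measure_pmf_finite finite_set_unif_cube finL)
    also have "\<dots> = expect ?P G"
    proof -
      have "glue L (bxor y (restr L e)) w = bxor (glue L y w) (restr L e)" for y e
        by (auto simp: glue_def bxor_def restr_def fun_eq_iff)
      then show ?thesis by (simp add: G_def[abs_def] F_def corr_def)
    qed
    finally show ?thesis .
  qed
  \<comment> \<open>The constant 10 is 2 + 8: differences \<open>2 * d\<close> over at most
    \<open>n\<close> inputs and \<open>4 * d\<close> over at most \<open>n\<close> blocks.\<close>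
  have "expect ?P (\<lambda>u. expect (unif_cube L) (\<lambda>y. exp (- l * F (glue L y w) u))) \<le>
      expect ?P (\<lambda>u. exp (l * (- G u)) * exp (2 * l\<^sup>2 * d\<^sup>2 * n))"
    by (intro expect_mono_finite finP inner)
  also have "\<dots> = expect ?P (\<lambda>u. exp (l * (- G u))) * exp (2 * l\<^sup>2 * d\<^sup>2 * n)"
    by simp
  also have "expect ?P (\<lambda>u. exp (l * (- G u))) \<le>
      exp (l * expect ?P (\<lambda>u. - G u) + l\<^sup>2 * (4 * d)\<^sup>2 / 2 * card {..<N})"
    by (rule expect_exp_bounded_differences[OF _ _ G_upd l]) (auto simp: finite_set_mixed_block_law)
  also have "\<dots> \<le> exp (- l * \<mu> + 8 * l\<^sup>2 * d\<^sup>2 * n)"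
  proof -
    have "l * \<mu> \<le> l * expect ?P G" using mean l by simp
    moreover have "l\<^sup>2 * d\<^sup>2 * N \<le> l\<^sup>2 * d\<^sup>2 * n" using N by (intro mult_left_mono) auto
    ultimately show ?thesis by (simp add: power_mult_distrib mult_ac)
  qed
  finally show ?thesis
    by (simp add: exp_add[symmetric] \<mu>_def algebra_simps)
qed

lemma expect_exp_corr:
  assumes B: "B = 2 ^ k - 1" "k \<ge> 1" and L: "L \<subseteq> {..<n}" and N: "N \<le> n"
    and d: "\<And>i. i \<in> L \<Longrightarrow> real (card (outputs_of n m h i)) \<le> d" "d \<ge> 0" and l: "l > 0"
  defines "F \<equiv> \<lambda>x u. corr n m h x (bxor x (restr L (noise B u)))"
  shows "expect (Pi_pmf {..<N} 0 (\<lambda>_. mixed_block_law k))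
      (\<lambda>u. expect (unif_cube {..<n}) (\<lambda>x. exp (- l * F x u))) \<le>
    exp (- l * (\<Sum>j<m. 4 powr (- real (card (inputs_of n h j)) / 2 ^ k)) + 10 * l\<^sup>2 * d\<^sup>2 * n)"
proof -
  let ?P = "Pi_pmf {..<N} 0 (\<lambda>_. mixed_block_law k)"
  have finL: "finite L" using L finite_subset by blast
  have finP: "finite (set_pmf ?P)"
    by (intro finite_set_Pi_pmf) (auto simp: finite_set_mixed_block_law)
  have "unif_cube {..<n} = unif_cube (L \<union> ({..<n} - L))"
    using L by (simp add: Un_absorb1)
  also have "\<dots> = map_pmf (\<lambda>(y, w). glue L y w) (pair_pmf (unif_cube L) (unif_cube ({..<n} - L)))"
    unfolding unif_cube_def glue_def using finL by (subst Pi_pmf_union) auto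
  finally have split: "expect (unif_cube {..<n}) f =
      expect (unif_cube ({..<n} - L)) (\<lambda>w. expect (unif_cube L) (\<lambda>y. f (glue L y w)))" for f
    using finL by (simp add: case_prod_unfold expect_pair_finite finite_set_unif_cube
        expect_swap_finite[of "unif_cube L"])
  have "expect ?P (\<lambda>u. expect (unif_cube {..<n}) (\<lambda>x. exp (- l * F x u))) =
      expect (unif_cube ({..<n} - L)) (\<lambda>w. expect ?P (\<lambda>u.
        expect (unif_cube L) (\<lambda>y. exp (- l * F (glue L y w) u))))"
    unfolding split using finP by (intro expect_swap_finite) (auto simp: finite_set_unif_cube)
  also have "\<dots> \<le> expect (unif_cube ({..<n} - L)) (\<lambda>w.
      exp (- l * (\<Sum>j<m. 4 powr (- real (card (inputs_of n h j)) / 2 ^ k)) + 10 * l\<^sup>2 * d\<^sup>2 * n))"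
    unfolding F_def
    by (intro expect_mono_finite finite_set_unif_cube expect_exp_corr_fixed[OF B L N d l]) auto
  finally show ?thesis by simp
qed

subsection \<open>The random source\<close>

lemma finite_bitstrings: "finite (bitstrings k)"
  unfolding bitstrings_def using finite_lists_length_eq[of "UNIV :: bool set" k] by simp

lemma bitstrings_nonempty: "bitstrings k \<noteq> {}"
  unfolding bitstrings_def using Ex_list_of_length by blast

lemma card_bitstrings: "card (bitstrings k) = 2 ^ k"
  unfolding bitstrings_def using card_lists_length_eq[of "UNIV :: bool set" k] by simp

lemma set_uniform_bits: "set_pmf (uniform_bits k) = bitstrings k"
  by (simp add: uniform_bits_def finite_bitstrings bitstrings_nonempty)

lemma uniform_bits_eq_map: "uniform_bits m = map_pmf (\<lambda>x. map x [0..<m]) (unif_cube {..<m})"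
proof -
  have "(i < m \<and> map x [0..<m] ! i) = x i" if "x \<in> cube {..<m}" for x i
    using that by (cases "i < m") (auto simp: mem_cube)
  then have "bij_betw (\<lambda>x. map x [0..<m]) (cube {..<m}) (bitstrings m)"
    by (intro bij_betw_byWitness[where f' = "\<lambda>ys i. i < m \<and> ys ! i"])
      (auto simp: mem_cube bitstrings_def fun_eq_iff intro!: nth_equalityI)
  then show ?thesis
    by (simp add: unif_cube_eq uniform_bits_def map_pmf_of_set_bij_betw finite_cube cube_nonempty)
qed

text \<open>The sum has mean 0 and changes by at most 2 when one bit of \<open>y\<close> changes, so
  bounded differences apply.\<close>

lemma prob_uniform_bits_sign_sum:
  assumes \<sigma>: "\<And>j. \<bar>\<sigma> j\<bar> = (1::real)" and t: "t > 0" and m: "m > 0"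
  shows "measure_pmf.prob (uniform_bits m) {y. t \<le> (\<Sum>j<m. sgn_bit (y ! j) * \<sigma> j)} \<le> exp (- t\<^sup>2 / (8 * m))"
proof -
  define f where "f x = (\<Sum>j<m. sgn_bit (x j) * \<sigma> j)" for x
  \<comment> \<open>This value minimises the exponent \<open>- l * t + 2 * l^2 * m\<close>.\<close>
  define l where "l = t / (4 * m)"
  have l: "l > 0" using t m by (simp add: l_def)
  have upd: "\<bar>f (x(i := v)) - f x\<bar> \<le> 2" if "i \<in> {..<m}" for x i v
  proof -
    have "f (x(i := v)) - f x = (\<Sum>j<m. if j = i then (sgn_bit v - sgn_bit (x i)) * \<sigma> i else 0)"
      unfolding f_def sum_subtractf[symmetric] by (intro sum.cong) (auto simp: algebra_simps)
    also have "\<dots> = (sgn_bit v - sgn_bit (x i)) * \<sigma> i" using that by simp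
    finally show ?thesis using \<sigma>[of i] by (auto simp: abs_mult sgn_bit_def)
  qed
  have fin: "finite (set_pmf (unif_cube {..<m}))" by (simp add: finite_set_unif_cube)
  have "expect (unif_cube {..<m}) f = (\<Sum>j<m. expect (unif_cube {..<m}) (\<lambda>x. sgn_bit (x j)) * \<sigma> j)"
    unfolding f_def by (simp add: integrable_measure_pmf_finite[OF fin])
  also have "\<dots> = 0"
  proof (rule sum.neutral, rule ballI)
    fix j assume "j \<in> {..<m}"
    then have "map_pmf (\<lambda>x. x j) (unif_cube {..<m}) = pmf_of_set UNIV"
      unfolding unif_cube_def by (subst Pi_pmf_component) auto
    moreover have "expect (unif_cube {..<m}) (\<lambda>x. sgn_bit (x j)) =
        expect (map_pmf (\<lambda>x. x j) (unif_cube {..<m})) sgn_bit"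
      by simp
    ultimately have "expect (unif_cube {..<m}) (\<lambda>x. sgn_bit (x j)) = expect (pmf_of_set UNIV) sgn_bit"
      by simp
    then show "expect (unif_cube {..<m}) (\<lambda>x. sgn_bit (x j)) * \<sigma> j = 0"
      by (simp add: integral_pmf_of_set UNIV_bool sgn_bit_def)
  qed
  finally have mean: "expect (unif_cube {..<m}) f = 0" .
  have "measure_pmf.prob (uniform_bits m) {y. t \<le> (\<Sum>j<m. sgn_bit (y ! j) * \<sigma> j)} =
      measure_pmf.prob (unif_cube {..<m}) {x. l * t \<le> l * f x}"
    unfolding uniform_bits_eq_map using l by (simp add: f_def vimage_def)
  also have "\<dots> \<le> exp (- (l * t)) * expect (unif_cube {..<m}) (\<lambda>x. exp (l * f x))"
    by (rule prob_ge_le_expect_exp[OF fin])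
  also have "expect (unif_cube {..<m}) (\<lambda>x. exp (l * f x)) \<le>
      exp (l * expect (unif_cube {..<m}) f + l\<^sup>2 * 2\<^sup>2 / 2 * card {..<m})"
    unfolding unif_cube_def by (rule expect_exp_bounded_differences[OF _ _ upd l]) auto
  finally have "measure_pmf.prob (uniform_bits m) {y. t \<le> (\<Sum>j<m. sgn_bit (y ! j) * \<sigma> j)} \<le>
      exp (- (l * t) + l\<^sup>2 * 2 * m)"
    by (simp add: mean mult_ac flip: exp_add)
  also have "- (l * t) + l\<^sup>2 * 2 * m = - t\<^sup>2 / (8 * m)"
    using m by (simp add: l_def field_simps power2_eq_square)
  finally show ?thesis .
qed

section \<open>Min-entropy of the sources\<close>

lemma min_entropy_ge:
  assumes "\<And>x. x \<in> set_pmf X \<Longrightarrow> pmf X x \<le> 2 powr (- c)"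
  shows "min_entropy X \<ge> c"
  unfolding min_entropy_def
proof (rule cINF_greatest)
  fix x assume x: "x \<in> set_pmf X"
  then have pos: "pmf X x > 0" by (simp add: pmf_positive)
  have "c = log 2 (1 / 2 powr (- c))" by (simp add: powr_minus_divide)
  also have "\<dots> \<le> log 2 (1 / pmf X x)"
    using assms[OF x] pos by (intro log_mono divide_left_mono) auto
  finally show "c \<le> log 2 (1 / pmf X x)" .
qed (rule set_pmf_not_empty)

lemma min_entropy_uniform_bits: "min_entropy (uniform_bits n) \<ge> n"
  by (rule min_entropy_ge)
    (simp add: uniform_bits_def finite_bitstrings bitstrings_nonempty card_bitstrings powr_minus_divide powr_realpow)

definition source :: "nat \<Rightarrow> nat \<Rightarrow> nat \<Rightarrow> (nat \<Rightarrow> bool) \<Rightarrow> (nat \<Rightarrow> bool) \<Rightarrow> bool list pmf" where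
  "source n k N r a = map_pmf (\<lambda>u. map (bxor r (noise (2 ^ k - 1) u)) [0..<n])
     (Pi_pmf {..<N} 0 (\<lambda>b. block_law k (a b)))"

text \<open>For fixed \<open>r\<close> the noise symbols can be read off from the output, so a point
  is as likely as its symbols; each active block contributes a factor
  \<open>1 / 2 ^ k\<close>.\<close>

lemma min_entropy_source:
  assumes B: "B = 2 ^ k - 1" and NB: "N * B \<le> n"
  shows "min_entropy (source n k N r a) \<ge> real k * card {b \<in> {..<N}. a b}"
proof (rule min_entropy_ge)
  let ?Q = "Pi_pmf {..<N} 0 (\<lambda>b. block_law k (a b))"
  let ?g = "\<lambda>u. map (bxor r (noise B u)) [0..<n]"
  have outside: "u b = 0" if "u \<in> set_pmf ?Q" "\<not> b < N" for u b
    using that set_Pi_pmf_subset[of "{..<N}" 0] by fastforce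
  have range: "u b < 2 ^ k" if "u \<in> set_pmf ?Q" for u b
  proof (cases "b < N")
    case True
    with that have "u b \<in> set_pmf (block_law k (a b))"
      by (auto simp: set_Pi_pmf PiE_dflt_def)
    then show ?thesis by (auto simp: block_law_def lessThan_empty_iff split: if_splits)
  qed (use outside[OF that] in simp)
  \<comment> \<open>A nonzero symbol is visible as a flip at a position below \<open>n\<close>. If
    both symbols are 0 there is nothing to show, and the remaining case follows by exchanging
    \<open>u\<close> and \<open>u'\<close>.\<close>
  have key: "u' b = u b" if u: "u \<in> set_pmf ?Q" and eq: "?g u = ?g u'" and nz: "u b \<noteq> 0" for u u' b
  proof -
    have "b < N" using outside u nz by metis
    obtain p where p: "u b = Suc p" using nz not0_implies_Suc by blast
    have "p < B" using range[OF u, of b] p B by auto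
    define i where "i = b * B + p"
    have i: "i div B = b" "i mod B = p" using \<open>p < B\<close> by (auto simp: i_def)
    have "i < Suc b * B" using \<open>p < B\<close> by (simp add: i_def)
    also have "\<dots> \<le> N * B" using \<open>b < N\<close> by (intro mult_right_mono) auto
    finally have "i < n" using NB by simp
    then have "noise B u i = noise B u' i"
      using eq by (auto simp: bxor_def)
    then show ?thesis using p i by (simp add: noise_def)
  qed
  have inj: "inj_on ?g (set_pmf ?Q)"
  proof (rule inj_onI, rule ext)
    fix u u' b assume *: "u \<in> set_pmf ?Q" "u' \<in> set_pmf ?Q" "?g u = ?g u'"
    show "u b = u' b"
      using key[OF *(1,3)] key[OF *(2) *(3)[symmetric]] by (cases "u b = 0") metis+
  qed
  fix x assume "x \<in> set_pmf (source n k N r a)"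
  then obtain u where u: "u \<in> set_pmf ?Q" "x = ?g u"
    by (auto simp: source_def B)
  have "pmf (source n k N r a) x = pmf ?Q u"
    using pmf_map_inj[OF inj u(1)] u(2) by (simp add: source_def B)
  also have "\<dots> = (\<Prod>b<N. pmf (block_law k (a b)) (u b))"
    using outside[OF u(1)] by (intro pmf_Pi') auto
  also have "\<dots> \<le> (\<Prod>b<N. if a b then 1 / 2 ^ k else 1)"
    by (intro prod_mono) (auto simp: block_law_def lessThan_empty_iff pmf_le_1 divide_right_mono indicator_def)
  also have "\<dots> = (1 / 2 ^ k) ^ card {b \<in> {..<N}. a b}"
    by (simp add: prod.If_cases Int_def)
  also have "\<dots> = 2 powr (- (real k * card {b \<in> {..<N}. a b}))"
    by (simp add: powr_minus_divide power_one_over flip: powr_realpow) (simp add: powr_powr flip: powr_realpow)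
  finally show "pmf (source n k N r a) x \<le> 2 powr (- (real k * card {b \<in> {..<N}. a b}))" .
qed

section \<open>Random choice of the active blocks\<close>

definition activity :: "nat \<Rightarrow> (nat \<Rightarrow> bool) pmf" where
  "activity N = Pi_pmf {..<N} False (\<lambda>_. bernoulli_pmf (3/8))"

definition enough :: "nat \<Rightarrow> (nat \<Rightarrow> bool) \<Rightarrow> bool" where
  "enough N a \<longleftrightarrow> N \<le> 4 * card {b \<in> {..<N}. a b}"

text \<open>
  Too few active blocks would spoil the min-entropy; in this unlikely case the source is replaced
  by the uniform one.
\<close>

definition source_law :: "nat \<Rightarrow> nat \<Rightarrow> nat \<Rightarrow> bool list pmf pmf" where
  "source_law n k N = map_pmf (\<lambda>(r, a). if enough N a then source n k N r a else uniform_bits n)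
     (pair_pmf (unif_cube {..<n}) (activity N))"

lemma finite_set_activity: "finite (set_pmf (activity N))"
  unfolding activity_def by (rule finite_set_Pi_pmf) (auto intro: finite_subset[OF subset_UNIV])

text \<open>The mean number of active blocks is \<open>3/8 * N\<close>, so failure is a deviation by
  \<open>N / 8\<close>. The count is negated to make this an upper tail, and the multiplier 1/8
  minimises \<open>- l * N / 8 + l^2 * N / 2\<close>.\<close>

lemma prob_not_enough: "measure_pmf.prob (activity N) {a. \<not> enough N a} \<le> exp (- real N / 128)"
proof -
  define f where "f a = - (\<Sum>b<N. of_bool (a b) :: real)" for a :: "nat \<Rightarrow> bool"
  have f: "f a = - real (card {b \<in> {..<N}. a b})" for a
    by (simp add: f_def of_bool_def sum.If_cases Int_def)
  have upd: "\<bar>f (a(i := v)) - f a\<bar> \<le> 1" if "i \<in> {..<N}" for a i v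
  proof -
    have "f (a(i := v)) - f a = (\<Sum>j<N. if j = i then of_bool (a i) - of_bool v else 0)"
      unfolding f_def minus_diff_minus sum_subtractf[symmetric] sum_negf[symmetric] by (intro sum.cong) auto
    also have "\<dots> = of_bool (a i) - of_bool v" using that by simp
    finally show ?thesis by simp
  qed
  have "expect (activity N) f = - (\<Sum>b<N. expect (activity N) (\<lambda>a. of_bool (a b)))"
    unfolding f_def integral_minus
    by (subst Bochner_Integration.integral_sum) (rule integrable_measure_pmf_finite[OF finite_set_activity], rule refl)
  also have "\<dots> = - (\<Sum>b<N. 3/8)"
  proof -
    have "expect (activity N) (\<lambda>a. of_bool (a b)) = 3/8" if "b \<in> {..<N}" for b
    proof -
      have "expect (activity N) (\<lambda>a. of_bool (a b)) = expect (map_pmf (\<lambda>a. a b) (activity N)) of_bool"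
        by simp
      also have "map_pmf (\<lambda>a. a b) (activity N) = bernoulli_pmf (3/8)"
        unfolding activity_def using that by (subst Pi_pmf_component) auto
      finally show ?thesis by simp
    qed
    then have "(\<Sum>b<N. expect (activity N) (\<lambda>a. of_bool (a b))) = (\<Sum>b<N. 3/8)"
      by (rule sum.cong[OF refl])
    then show ?thesis by simp
  qed
  finally have mean: "expect (activity N) f = - (3/8 * N)" by simp
  have "measure_pmf.prob (activity N) {a. \<not> enough N a} \<le>
      measure_pmf.prob (activity N) {a. 1/8 * (- N / 4) \<le> 1/8 * f a}"
    by (intro measure_pmf.finite_measure_mono) (auto simp: enough_def f)
  also have "\<dots> \<le> exp (- (1/8 * (- N / 4))) * expect (activity N) (\<lambda>a. exp (1/8 * f a))"
    by (rule prob_ge_le_expect_exp[OF finite_set_activity])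
  also have "expect (activity N) (\<lambda>a. exp (1/8 * f a)) \<le>
      exp (1/8 * expect (activity N) f + (1/8)\<^sup>2 * 1\<^sup>2 / 2 * card {..<N})"
    unfolding activity_def
    by (rule expect_exp_bounded_differences[OF _ _ upd]) (auto intro: finite_subset[OF subset_UNIV])
  finally show ?thesis
    by (simp add: mean exp_add[symmetric] power2_eq_square)
qed

section \<open>The test and its two kinds of error\<close>

lemma out_cong: "(\<And>i. i < n \<Longrightarrow> x i = y i) \<Longrightarrow> out n h j x = out n h j y"
  unfolding out_def by (intro arg_cong[where f = "\<lambda>xs. sgn_bit (h xs ! j)"] map_cong) auto

lemma finite_set_source: "finite (set_pmf (source n k N r a))"
  unfolding source_def by (auto intro!: finite_set_Pi_pmf simp: finite_set_block_law)

text \<open>The test \<open>T\<close> may use \<open>r\<close> but not the sample \<open>x\<close>.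
  Undoing the noise off \<open>H\<close> turns \<open>x\<close> into \<open>r\<close> there and
  keeps \<open>x\<close> on \<open>H\<close>; the result is one of the \<open>2 ^ card H\<close>
  candidates \<open>z S\<close>. Hence \<open>T\<close> tries all of them, and a union bound
  controls the uniform string.\<close>

lemma stat_dist_source_ge:
  assumes m: "m > 0" and t: "t > 0" and H: "H \<subseteq> {..<n}"
  shows "stat_dist (map_pmf h (source n k N r a)) (uniform_bits m) \<ge>
    1 - 2 ^ card H * exp (- t\<^sup>2 / (8 * m)) -
    measure_pmf.prob (Pi_pmf {..<N} 0 (\<lambda>b. block_law k (a b)))
      {u. corr n m h (bxor r (noise (2 ^ k - 1) u))
        (bxor (bxor r (noise (2 ^ k - 1) u)) (restr ({..<n} - H) (noise (2 ^ k - 1) u))) < t}"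
    (is "_ \<ge> 1 - ?p - measure_pmf.prob ?Q ?bad")
proof -
  let ?e = "noise (2 ^ k - 1)"
  define z where "z S = (\<lambda>i. if i \<in> H then i \<in> S else r i)" for S
  define T where "T = (\<Union>S\<in>Pow H. {y. t \<le> (\<Sum>j<m. sgn_bit (y ! j) * out n h j (z S))})"
  have finH: "finite H" using H finite_subset by blast
  have "measure_pmf.prob (uniform_bits m) T \<le>
      (\<Sum>S\<in>Pow H. measure_pmf.prob (uniform_bits m) {y. t \<le> (\<Sum>j<m. sgn_bit (y ! j) * out n h j (z S))})"
    unfolding T_def using finH by (intro measure_pmf.finite_measure_subadditive_finite) auto
  also have "\<dots> \<le> (\<Sum>S\<in>Pow H. exp (- t\<^sup>2 / (8 * m)))"
    by (intro sum_mono prob_uniform_bits_sign_sum abs_out t m)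
  also have "\<dots> = ?p" using finH by (simp add: card_Pow)
  finally have U: "measure_pmf.prob (uniform_bits m) T \<le> ?p" .
  have "1 - measure_pmf.prob ?Q ?bad = measure_pmf.prob ?Q (- ?bad)"
    using measure_pmf.prob_compl[of ?bad ?Q] by (simp add: Compl_eq_Diff_UNIV)
  also have "\<dots> \<le> measure_pmf.prob ?Q {u. h (map (bxor r (?e u)) [0..<n]) \<in> T}"
  proof (rule measure_pmf.finite_measure_mono)
    show "- ?bad \<subseteq> {u. h (map (bxor r (?e u)) [0..<n]) \<in> T}"
    proof
      fix u assume "u \<in> - ?bad"
      define x where "x = bxor r (?e u)"
      have "t \<le> corr n m h x (bxor x (restr ({..<n} - H) (?e u)))"
        using \<open>u \<in> - ?bad\<close> by (simp add: x_def)
      also have "\<dots> = (\<Sum>j<m. sgn_bit (h (map x [0..<n]) ! j) * out n h j (z {i \<in> H. x i}))"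
        unfolding corr_def
      proof (rule sum.cong)
        fix j
        have "out n h j (bxor x (restr ({..<n} - H) (?e u))) = out n h j (z {i \<in> H. x i})"
          by (rule out_cong) (auto simp: bxor_def restr_def z_def x_def)
        then show "out n h j x * out n h j (bxor x (restr ({..<n} - H) (?e u))) =
            sgn_bit (h (map x [0..<n]) ! j) * out n h j (z {i \<in> H. x i})"
          by (simp add: out_def)
      qed simp
      finally show "u \<in> {u. h (map (bxor r (?e u)) [0..<n]) \<in> T}"
        unfolding T_def x_def[symmetric] by (auto simp: x_def)
    qed
  qed simp
  also have "\<dots> = measure_pmf.prob (map_pmf h (source n k N r a)) T"
    by (simp add: source_def vimage_def)
  finally have "measure_pmf.prob (map_pmf h (source n k N r a)) T \<ge> 1 - measure_pmf.prob ?Q ?bad" .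
  moreover have "stat_dist (map_pmf h (source n k N r a)) (uniform_bits m) \<ge>
      measure_pmf.prob (map_pmf h (source n k N r a)) T - measure_pmf.prob (uniform_bits m) T"
    by (rule stat_dist_ge) (auto simp: finite_set_source set_uniform_bits finite_bitstrings)
  ultimately show ?thesis using U by simp
qed

subsection \<open>The distinguisher\<close>

text \<open>Averaged over the activity, the symbols are independent and identically distributed,
  which is the setting of the noise stability bound.\<close>

lemma bind_activity:
  "bind_pmf (activity N) (\<lambda>a. Pi_pmf {..<N} 0 (\<lambda>b. block_law k (a b))) =
    Pi_pmf {..<N} 0 (\<lambda>_. mixed_block_law k)"
  unfolding activity_def mixed_block_law_def by (rule Pi_pmf_bind[symmetric]) simp

text \<open>All blocks fit into the first \<open>n\<close> positions, so adding the noise preserves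
  the uniform law on the cube.\<close>

lemma noise_in_cube:
  assumes "\<And>b. \<not> b < N \<Longrightarrow> u b = 0" "N * B \<le> n" "B > 0"
  shows "noise B u \<in> cube {..<n}"
proof -
  have "i < n" if "u (i div B) = Suc (i mod B)" for i
  proof -
    have "i div B < N" using assms(1)[of "i div B"] that by auto
    then have "i < N * B" using assms(3) by (simp add: div_less_iff_less_mult)
    then show ?thesis using assms(2) by simp
  qed
  then show ?thesis by (auto simp: mem_cube noise_def)
qed

text \<open>The three losses are: too few active blocks, a uniform string that passes the test, and
  a sample whose correlation stays below \<open>t\<close>.\<close>

lemma expect_stat_dist_ge:
  fixes h :: "bool list \<Rightarrow> bool list"
  assumes B: "B = 2 ^ k - 1" "k \<ge> 1" and NB: "N * B \<le> n"
    and m: "m > 0" and d: "d \<ge> 0" and t: "t > 0" and l: "l > 0"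
  defines "H \<equiv> {i \<in> {..<n}. real (card (outputs_of n m h i)) > d}"
  shows "expect (source_law n k N) (\<lambda>X. stat_dist (map_pmf h X) (uniform_bits m)) \<ge>
    1 - exp (- real N / 128) - 2 ^ card H * exp (- t\<^sup>2 / (8 * m)) -
    exp (l * t - l * (\<Sum>j<m. 4 powr (- real (card (inputs_of n h j)) / 2 ^ k)) + 10 * l\<^sup>2 * d\<^sup>2 * n)"
proof -
  let ?R = "unif_cube {..<n}"
  let ?P = "Pi_pmf {..<N} 0 (\<lambda>_. mixed_block_law k)"
  let ?Q = "\<lambda>a. Pi_pmf {..<N} 0 (\<lambda>b. block_law k (a b))"
  define L where "L = {..<n} - H"
  define F where "F x u = corr n m h x (bxor x (restr L (noise B u)))" for x u
  define p where "p = 2 ^ card H * exp (- t\<^sup>2 / (8 * m))"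
  define \<mu> where "\<mu> = (\<Sum>j<m. 4 powr (- real (card (inputs_of n h j)) / 2 ^ k))"
  have H: "H \<subseteq> {..<n}" by (auto simp: H_def)
  have "(2::nat) ^ 1 \<le> 2 ^ k" using B(2) by (intro power_increasing) auto
  then have "B \<ge> 1" using B(1) by simp
  then have Nn: "N \<le> n" using NB by (metis le_trans mult.right_neutral mult_le_mono2)
  have finR: "finite (set_pmf ?R)" by (simp add: finite_set_unif_cube)
  have finP: "finite (set_pmf ?P)"
    by (intro finite_set_Pi_pmf) (auto simp: finite_set_mixed_block_law)
  have finQ: "finite (set_pmf (?Q a))" for a
    by (intro finite_set_Pi_pmf) (auto simp: finite_set_block_law)
  have finRA: "finite (set_pmf (pair_pmf ?R (activity N)))"
    using finR by (simp add: finite_set_activity)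
  have p: "p \<ge> 0" by (simp add: p_def)
  \<comment> \<open>Without enough active blocks the indicator makes the left side nonpositive, and
    the distance is nonnegative.\<close>
  have pointwise: "1 - p - indicator {a. \<not> enough N a} a -
        expect (?Q a) (indicator {u. F (bxor r (noise B u)) u < t}) \<le>
      stat_dist (map_pmf h (if enough N a then source n k N r a else uniform_bits n)) (uniform_bits m)" for r a
  proof (cases "enough N a")
    case True
    have "1 - p - measure_pmf.prob (?Q a) {u. F (bxor r (noise B u)) u < t} \<le>
        stat_dist (map_pmf h (source n k N r a)) (uniform_bits m)"
      using stat_dist_source_ge[OF m t H, where h = h and k = k and N = N and r = r and a = a] unfolding F_def L_def p_def B by simp
    with True show ?thesis by simp
  next
    case False
    then show ?thesis
      using p stat_dist_nonneg[of "map_pmf h (uniform_bits n)" "uniform_bits m"]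
      by simp (smt (verit) measure_nonneg)
  qed
  have tail: "expect ?R (\<lambda>r. expect (activity N) (\<lambda>a.
      expect (?Q a) (indicator {u. F (bxor r (noise B u)) u < t}))) \<le>
      exp (l * t - l * \<mu> + 10 * l\<^sup>2 * d\<^sup>2 * n)"
  proof -
    have "expect ?R (\<lambda>r. expect (activity N) (\<lambda>a.
        expect (?Q a) (indicator {u. F (bxor r (noise B u)) u < t}))) =
        expect ?R (\<lambda>r. expect ?P (indicator {u. F (bxor r (noise B u)) u < t}))"
      unfolding bind_activity[symmetric]
      by (subst expect_bind_finite) (auto simp: finite_set_activity finQ)
    \<comment> \<open>Exponential Markov bound: \<open>F < t\<close> implies
      \<open>1 \<le> exp (l * t - l * F)\<close>.\<close>
    also have "\<dots> \<le> expect ?R (\<lambda>r. expect ?P (\<lambda>u. exp (l * t) * exp (- l * F (bxor r (noise B u)) u)))"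
      using l by (intro expect_mono_finite finR finP)
        (auto simp: indicator_def mult_le_cancel_left simp flip: exp_add)
    also have "\<dots> = expect ?P (\<lambda>u. expect ?R (\<lambda>r. exp (l * t) * exp (- l * F (bxor r (noise B u)) u)))"
      by (rule expect_swap_finite[OF finR finP])
    \<comment> \<open>The sample \<open>bxor r (noise B u)\<close> is uniform and independent of \<open>u\<close>.\<close>
    also have "\<dots> = expect ?P (\<lambda>u. expect ?R (\<lambda>x. exp (l * t) * exp (- l * F x u)))"
    proof (rule integral_cong_AE[OF _ _ AE_pmfI])
      fix u assume u: "u \<in> set_pmf ?P"
      have "u b = 0" if "\<not> b < N" for b
        using u that set_Pi_pmf_subset[of "{..<N}" 0] by fastforce
      then have "noise B u \<in> cube {..<n}" using NB \<open>B \<ge> 1\<close> by (intro noise_in_cube) auto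
      then have "map_pmf (\<lambda>x. bxor x (noise B u)) ?R = ?R"
        by (intro map_bxor_unif_cube) auto
      then have "expect ?R (\<lambda>x. exp (l * t) * exp (- l * F x u)) =
          expect (map_pmf (\<lambda>x. bxor x (noise B u)) ?R) (\<lambda>x. exp (l * t) * exp (- l * F x u))"
        by simp
      then show "expect ?R (\<lambda>r. exp (l * t) * exp (- l * F (bxor r (noise B u)) u)) =
          expect ?R (\<lambda>x. exp (l * t) * exp (- l * F x u))"
        by simp
    qed auto
    also have "\<dots> = exp (l * t) * expect ?P (\<lambda>u. expect ?R (\<lambda>x. exp (- l * F x u)))"
      by simp
    also have "\<dots> \<le> exp (l * t) * exp (- l * \<mu> + 10 * l\<^sup>2 * d\<^sup>2 * n)"
      unfolding F_def \<mu>_def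
      by (intro mult_left_mono expect_exp_corr[OF B _ Nn _ d l]) (auto simp: L_def H_def)
    finally show ?thesis by (simp add: exp_add[symmetric] algebra_simps)
  qed
  have "1 - p - exp (- real N / 128) - exp (l * t - l * \<mu> + 10 * l\<^sup>2 * d\<^sup>2 * n) \<le>
      1 - p - measure_pmf.prob (activity N) {a. \<not> enough N a} - expect ?R (\<lambda>r. expect (activity N) (\<lambda>a.
      expect (?Q a) (indicator {u. F (bxor r (noise B u)) u < t})))"
    using tail prob_not_enough[of N] by simp
  also have "\<dots> = expect (pair_pmf ?R (activity N)) (\<lambda>(r, a). 1 - p - indicator {a. \<not> enough N a} a -
        expect (?Q a) (indicator {u. F (bxor r (noise B u)) u < t}))"
    using finR finite_set_activity[of N]
    by (simp add: expect_pair_finite integrable_measure_pmf_finite)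
  also have "\<dots> \<le> expect (pair_pmf ?R (activity N)) (\<lambda>(r, a).
      stat_dist (map_pmf h (if enough N a then source n k N r a else uniform_bits n)) (uniform_bits m))"
    using pointwise by (intro expect_mono_finite[OF finRA]) auto
  also have "\<dots> = expect (source_law n k N) (\<lambda>X. stat_dist (map_pmf h X) (uniform_bits m))"
    by (simp add: source_law_def case_prod_unfold)
  finally show ?thesis by (simp add: p_def \<mu>_def algebra_simps)
qed

text \<open>A quarter of the blocks with \<open>k\<close> bits each gives \<open>k * N / 4\<close>,
  which is at least \<open>1.5 * m\<close>; the uniform fallback has \<open>n \<ge> 6 * m\<close>
  bits.\<close>

lemma source_law_support:
  assumes "X \<in> set_pmf (source_law n k N)" and B: "B = 2 ^ k - 1" and NB: "N * B \<le> n"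
    and "6 * m \<le> n" "6 * m \<le> k * N"
  shows "set_pmf X \<subseteq> bitstrings n" "min_entropy X \<ge> 1.5 * real m"
proof -
  from assms(1) obtain r a where X: "X = (if enough N a then source n k N r a else uniform_bits n)"
    by (auto simp: source_law_def)
  then show "set_pmf X \<subseteq> bitstrings n"
    by (auto simp: set_uniform_bits source_def bitstrings_def)
  show "min_entropy X \<ge> 1.5 * real m"
  proof (cases "enough N a")
    case True
    have "6 * m \<le> k * (4 * card {b \<in> {..<N}. a b})"
      using assms(5) mult_le_mono2[of N "4 * card {b \<in> {..<N}. a b}" k] True
      unfolding enough_def by linarith
    then have "real (6 * m) \<le> real (k * (4 * card {b \<in> {..<N}. a b}))"
      by (rule of_nat_mono)
    then have "1.5 * real m \<le> real k * card {b \<in> {..<N}. a b}"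
      by simp
    also have "\<dots> \<le> min_entropy X"
      using True X min_entropy_source[OF B NB] by simp
    finally show ?thesis .
  next
    case False
    have "1.5 * real m \<le> real n" using assms(4) by linarith
    with False X min_entropy_uniform_bits[of n] show ?thesis by simp
  qed
qed

text \<open>Jensen's inequality, via the tangent at the mean.\<close>

lemma sum_four_powr_ge:
  assumes "m > 0"
  shows "(\<Sum>j<m. 4 powr (- x j)) \<ge> real m * 4 powr (- (\<Sum>j<m. x j) / m)"
proof -
  define a where "a = (\<Sum>j<m. x j) / m"
  have "real m * 4 powr (- a) = (\<Sum>j<m. 4 powr (- a) * (1 + (a - x j) * ln 4))"
    using assms by (simp add: a_def sum.distrib sum_subtractf flip: sum_distrib_left sum_distrib_right)
  also have "\<dots> \<le> (\<Sum>j<m. 4 powr (- x j))"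
  proof (rule sum_mono)
    fix j
    have "4 powr (- a) * (1 + (a - x j) * ln 4) \<le> 4 powr (- a) * exp ((a - x j) * ln 4)"
      by (intro mult_left_mono exp_ge_add_one_self) auto
    also have "\<dots> = 4 powr (- x j)"
      by (simp add: powr_def algebra_simps flip: exp_add)
    finally show "4 powr (- a) * (1 + (a - x j) * ln 4) \<le> 4 powr (- x j)" .
  qed
  finally show ?thesis by (simp add: a_def)
qed

text \<open>The largest \<open>k\<close> for which a quarter of the blocks still carries entropy \<open>1.5 * m\<close>.\<close>

lemma block_parameters:
  fixes n m :: nat
  assumes "6 * m \<le> n" "m > 0"
  obtains k N :: nat where "k \<ge> 1" "N * (2 ^ k - 1) \<le> n" "6 * m \<le> k * N" "2 ^ k \<le> n + 1"
    "(k + 1) * n < 2 ^ (k + 1) * (6 * m + k + 1)"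
proof -
  define P where "P k \<longleftrightarrow> k \<ge> 1 \<and> 6 * m \<le> k * (n div (2 ^ k - 1))" for k :: nat
  have bound: "2 ^ k \<le> n + 1" if "P k" for k
  proof -
    have "n div (2 ^ k - 1) \<noteq> 0" using that assms(2) by (auto simp: P_def intro: ccontr)
    then have "2 ^ k - 1 \<le> n" by (metis div_less not_less)
    then show ?thesis by simp
  qed
  have "k \<le> n" if "P k" for k
    using bound[OF that] less_exp[of k] by linarith
  \<comment> \<open>\<open>P 1\<close> is the hypothesis \<open>6 * m \<le> n\<close>, and
    \<open>P k\<close> forces \<open>k \<le> n\<close>, so a largest such \<open>k\<close>
    exists.\<close>
  moreover have "P 1" using assms by (simp add: P_def)
  ultimately obtain k where k: "P k" "\<not> P (Suc k)"
    using GreatestI_nat[of P 1 n] Greatest_le_nat[of P _ n] by (metis Suc_n_not_le_n)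
  define M :: nat where "M = 2 ^ (k + 1) - 1"
  have M: "M < 2 ^ (k + 1)" "M > 0"
    by (auto simp: M_def) (metis One_nat_def Suc_lessI lessI n_less_m_mult_n numeral_2_eq_2 one_less_mult pos2 zero_less_power)
  \<comment> \<open>Failure of \<open>P (k + 1)\<close> bounds the number of blocks of the next
    size. Together with the remainder of the division this bounds \<open>n\<close> from above, so
    \<open>2 ^ k\<close> is not too small.\<close>
  have lt: "(k + 1) * (n div M) < 6 * m"
    using k(2) by (simp add: P_def M_def)
  have "n < (n div M + 1) * M"
    using M(2) by (metis Suc_eq_plus1 dividend_less_times_div mult.commute add.commute mult_Suc)
  then have "(k + 1) * n \<le> (k + 1) * ((n div M + 1) * M)" by (intro mult_left_mono) auto
  also have "\<dots> = M * ((k + 1) * (n div M) + (k + 1))" by (simp add: algebra_simps)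
  also have "\<dots> \<le> 2 ^ (k + 1) * ((k + 1) * (n div M) + (k + 1))"
    using M(1) by (intro mult_right_mono) auto
  also have "\<dots> < 2 ^ (k + 1) * (6 * m + k + 1)"
    using lt by (intro mult_strict_left_mono) auto
  finally have "(k + 1) * n < 2 ^ (k + 1) * (6 * m + k + 1)" .
  then show ?thesis
    using k(1) bound[OF k(1)] by (intro that[of k "n div (2 ^ k - 1)"]) (auto simp: P_def)
qed

subsection \<open>Parameters\<close>

text \<open>Markov's inequality for the number of outputs per input, whose total is the
  sparsity.\<close>

lemma card_heavy_inputs:
  assumes "d > 0"
  shows "real (card {i \<in> {..<n}. real (card (outputs_of n m h i)) > d}) \<le> real (sparsity n m h) / d"
proof -
  let ?H = "{i \<in> {..<n}. real (card (outputs_of n m h i)) > d}"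
  have "d * real (card ?H) = (\<Sum>i\<in>?H. d)" by simp
  also have "\<dots> \<le> (\<Sum>i\<in>?H. real (card (outputs_of n m h i)))" by (intro sum_mono) auto
  also have "\<dots> \<le> (\<Sum>i<n. real (card (outputs_of n m h i)))" by (intro sum_mono2) auto
  also have "\<dots> = real (sparsity n m h)" by (simp add: sparsity_eq_sum_outputs)
  finally show ?thesis using assms by (simp add: field_simps)
qed

text \<open>By Jensen only the total number of dependencies matters. The choice of \<open>k\<close>
  gives \<open>n / m < 24 * 2 ^ k / (k + 1)\<close> and a logarithmic factor of at most
  \<open>3 * (k + 1)\<close>. The factors \<open>k + 1\<close> cancel, and the exponent to base 2 is
  at most \<open>0.144 * log 2 m\<close>.\<close>

lemma sum_powr_inputs_ge:
  fixes n m k :: nat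
  assumes m: "m > 0" and k: "k \<ge> 1" and small: "real (k + 1) * n < 2 ^ (k + 1) * (12 * m)"
    and nm: "6 * m \<le> n"
    and s: "real (sparsity n m h) \<le> 0.001 * real n * log 2 m * log 2 (2 * real n / real m)"
  shows "(\<Sum>j<m. 4 powr (- real (card (inputs_of n h j)) / 2 ^ k)) \<ge> real m powr 0.85"
proof -
  define \<Lambda> where "\<Lambda> = log 2 (2 * real n / real m)"
  have n: "n > 0" using m nm by simp
  have ratio: "real n / m < 24 * 2 ^ k / (k + 1)"
    using small m by (simp add: field_simps)
  \<comment> \<open>The aim is only a bound linear in \<open>k\<close> for the logarithm;
    \<open>k + 5 \<le> 3 * (k + 1)\<close> holds from \<open>k = 1\<close> on.\<close>
  have "2 * real n / m < 48 * 2 ^ k / (k + 1)" using ratio by simp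
  also have "\<dots> \<le> 48 * 2 ^ k / 2" using k by (intro divide_left_mono) auto
  also have "\<dots> \<le> 2 ^ (k + 5)" by (simp add: power_add)
  also have "\<dots> \<le> 2 ^ (3 * (k + 1))" using k by (intro power_increasing) auto
  finally have "\<Lambda> \<le> log 2 (2 ^ (3 * (k + 1)))"
    unfolding \<Lambda>_def using n m by (intro log_mono) auto
  also have "\<dots> = 3 * (real k + 1)" by (simp add: log_nat_power)
  finally have \<Lambda>: "\<Lambda> \<le> 3 * (real k + 1)" .
  have "2 * real n / m \<ge> 1" using nm m by (simp add: field_simps)
  then have \<Lambda>0: "\<Lambda> \<ge> 0" unfolding \<Lambda>_def by simp
  have logm: "log 2 m \<ge> 0" using m by simp
  have "2 * (real (sparsity n m h) / 2 ^ k) / m \<le> 0.002 * (real n / m) / 2 ^ k * \<Lambda> * log 2 m"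
    using s m unfolding \<Lambda>_def[symmetric] by (simp add: field_simps)
  also have "\<dots> \<le> 0.002 * (24 * 2 ^ k / (k + 1)) / 2 ^ k * (3 * (real k + 1)) * log 2 m"
    using ratio \<Lambda> \<Lambda>0 logm by (intro mult_mono divide_right_mono mult_nonneg_nonneg) auto
  also have "\<dots> = 0.144 * log 2 m"
  proof -
    have "0.002 * (24 * 2 ^ k / q) / 2 ^ k * (3 * q) * y = 0.144 * y" if "q > 0" for q y :: real
      using that by simp
    from this[of "real k + 1" "log 2 m"] show ?thesis by (simp add: add.commute)
  qed
  also have "\<dots> \<le> 0.15 * log 2 m" using logm by simp
  finally have ex: "2 * (real (sparsity n m h) / 2 ^ k) / m \<le> 0.15 * log 2 m" .
  have "real m powr 0.85 = real m powr (1 + - 0.15)" by simp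
  also have "\<dots> = real m * real m powr (- 0.15)" unfolding powr_add using m by simp
  also have "real m powr (- 0.15) = 2 powr (- (0.15 * log 2 m))"
    using m by (simp add: powr_def log_def)
  also have "real m * \<dots> \<le> real m * 2 powr (- (2 * (real (sparsity n m h) / 2 ^ k) / m))"
    using ex by (intro mult_left_mono powr_mono) auto
  also have "2 powr (- (2 * (real (sparsity n m h) / 2 ^ k) / m)) =
      (2 powr 2) powr (- (real (sparsity n m h) / 2 ^ k) / m)"
    unfolding powr_powr by simp
  also have "2 powr 2 = (4::real)" by simp
  also have "real (sparsity n m h) / 2 ^ k = (\<Sum>j<m. real (card (inputs_of n h j)) / 2 ^ k)"
    by (simp add: sparsity_eq_sum_inputs sum_divide_distrib)
  also have "real m * 4 powr (- (\<Sum>j<m. real (card (inputs_of n h j)) / 2 ^ k) / m) \<le>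
      (\<Sum>j<m. 4 powr (- (real (card (inputs_of n h j)) / 2 ^ k)))"
    using sum_four_powr_ge[OF m] by blast
  finally show ?thesis by simp
qed

text \<open>Here \<open>x\<close> stands for \<open>m\<close>, and 100/99 comes from inverting
  \<open>n powr 0.99 \<le> m\<close>. The conditions serve, in order, the bound on \<open>k\<close>,
  the number of blocks, the union bound over heavy inputs, the correlation tail and the sum of three
  errors. The decisive margins are 100/99 - 0.33 < 0.7 and 1.7 - 0.66 - 100/99 > 0.02.\<close>

lemma eventually_large:
  "eventually (\<lambda>x::real. x \<ge> 2 \<and> 2 + 2 * log 2 x \<le> 6 * x \<and>
     x powr 0.02 \<le> 6 * x / (1 + 2 * log 2 x) / 128 \<and>
     0.001 * x powr (100/99) * log 2 x * (1 + 2 * log 2 x) / x powr 0.33 + x powr 0.02 \<le> x powr 0.7 / 32 \<and>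
     x powr 0.02 \<le> x powr 1.7 / (160 * x powr 0.66 * x powr (100/99)) \<and>
     3 * exp (- (x powr 0.02)) \<le> exp (- (x powr 0.01))) at_top"
  by (intro eventually_conj; real_asymp)

theorem theorem2:
  shows "\<exists>c::real. c > 0 \<and> (\<exists>n0::nat. \<forall>n m :: nat. n \<ge> n0 \<and> real n powr 0.99 \<le> real m \<and> real m \<le> real n / 6 \<longrightarrow>
    (\<exists>D :: bool list pmf pmf.
       (\<forall>X\<in>set_pmf D. set_pmf X \<subseteq> bitstrings n \<and> min_entropy X \<ge> 1.5 * real m) \<and>
       (\<forall>h :: bool list \<Rightarrow> bool list.
          (\<forall>x\<in>bitstrings n. h x \<in> bitstrings m) \<and>
          real (sparsity n m h) \<le> 0.001 * real n * log 2 (real m) * log 2 (2 * real n / real m) \<longrightarrow>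
          measure_pmf.expectation D (\<lambda>X. stat_dist (map_pmf h X) (uniform_bits m))
            \<ge> 1 - exp (- (real m powr c)))))"
proof -
  obtain x0 :: real where x0: "\<And>x. x \<ge> x0 \<Longrightarrow> x \<ge> 2 \<and> 2 + 2 * log 2 x \<le> 6 * x \<and>
     x powr 0.02 \<le> 6 * x / (1 + 2 * log 2 x) / 128 \<and>
     0.001 * x powr (100/99) * log 2 x * (1 + 2 * log 2 x) / x powr 0.33 + x powr 0.02 \<le> x powr 0.7 / 32 \<and>
     x powr 0.02 \<le> x powr 1.7 / (160 * x powr 0.66 * x powr (100/99)) \<and>
     3 * exp (- (x powr 0.02)) \<le> exp (- (x powr 0.01))"
    using eventually_large unfolding eventually_at_top_linorder by blast
  \<comment> \<open>Largeness of \<open>n\<close> makes \<open>m\<close> large, because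
    \<open>m\<close> is at least \<open>n powr 0.99\<close>.\<close>
  have "filterlim (\<lambda>n::nat. real n powr 0.99) at_top at_top" by real_asymp
  then obtain n0 :: nat where n0: "\<And>n. n \<ge> n0 \<Longrightarrow> real n powr 0.99 \<ge> x0"
    unfolding filterlim_at_top eventually_at_top_linorder by blast
  have "\<exists>D :: bool list pmf pmf.
       (\<forall>X\<in>set_pmf D. set_pmf X \<subseteq> bitstrings n \<and> min_entropy X \<ge> 1.5 * real m) \<and>
       (\<forall>h :: bool list \<Rightarrow> bool list.
          (\<forall>x\<in>bitstrings n. h x \<in> bitstrings m) \<and>
          real (sparsity n m h) \<le> 0.001 * real n * log 2 (real m) * log 2 (2 * real n / real m) \<longrightarrow>
          measure_pmf.expectation D (\<lambda>X. stat_dist (map_pmf h X) (uniform_bits m))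
            \<ge> 1 - exp (- (real m powr 0.01)))"
    if "n \<ge> n0" and nm: "real n powr 0.99 \<le> real m" and mn: "real m \<le> real n / 6" for n m :: nat
  proof -
    have "real m \<ge> x0" using n0[OF \<open>n \<ge> n0\<close>] nm by simp
    from x0[OF this] have "real m \<ge> 2" and large: "2 + 2 * log 2 m \<le> 6 * real m"
      "real m powr 0.02 \<le> 6 * real m / (1 + 2 * log 2 m) / 128"
      "0.001 * real m powr (100/99) * log 2 m * (1 + 2 * log 2 m) / real m powr 0.33 + real m powr 0.02
        \<le> real m powr 0.7 / 32"
      "real m powr 0.02 \<le> real m powr 1.7 / (160 * real m powr 0.66 * real m powr (100/99))"
      "3 * exp (- (real m powr 0.02)) \<le> exp (- (real m powr 0.01))"
      by blast+
    then have m: "m > 0" by auto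
    have mn': "6 * m \<le> n" using mn by linarith
    have n: "n > 0" using m mn' by simp
    have "real n = (real n powr 0.99) powr (100/99)" using n by (simp add: powr_powr)
    also have "\<dots> \<le> real m powr (100/99)" using nm by (intro powr_mono2) auto
    finally have n_le: "real n \<le> real m powr (100/99)" .
    have log_m: "log 2 m \<ge> 0" using m by simp
    have "log 2 (2 * real n) = 1 + log 2 n" using n by (simp add: log_mult)
    also have "log 2 n \<le> log 2 (real m powr (100/99))" using n_le n by (intro log_mono) auto
    also have "\<dots> = 100/99 * log 2 m" using m by (simp add: log_powr)
    also have "\<dots> \<le> 2 * log 2 m" using log_m by simp
    finally have log2n: "log 2 (2 * real n) \<le> 1 + 2 * log 2 m" by simp
    obtain k N where k: "k \<ge> 1" and NB: "N * (2 ^ k - 1) \<le> n" and kN: "6 * m \<le> k * N"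
      and kn: "2 ^ k \<le> n + 1" and small: "(k + 1) * n < 2 ^ (k + 1) * (6 * m + k + 1)"
      using block_parameters[OF mn' m] by blast
    have "real k = log 2 (2 ^ k)" by simp
    also have "\<dots> \<le> log 2 (2 * real n)"
    proof (rule log_mono)
      have "2 ^ k \<le> 2 * n" using kn n by linarith
      then have "real (2 ^ k) \<le> real (2 * n)" by (rule of_nat_mono)
      then show "2 ^ k \<le> 2 * real n" by simp
    qed auto
    finally have k_le: "real k \<le> 1 + 2 * log 2 m" using log2n by simp
    then have "k + 1 \<le> 6 * m" using large(1) by linarith
    then have "2 ^ (k + 1) * (6 * m + k + 1) \<le> 2 ^ (k + 1) * (12 * m)" by (intro mult_left_mono) auto
    with small have "(k + 1) * n < 2 ^ (k + 1) * (12 * m)" by linarith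
    then have "real ((k + 1) * n) < real (2 ^ (k + 1) * (12 * m))" by (rule of_nat_less_iff[THEN iffD2])
    then have small': "real (k + 1) * n < 2 ^ (k + 1) * (12 * m)"
      by (simp add: algebra_simps)
    have N: "real N / 128 \<ge> real m powr 0.02"
    proof -
      have "6 * real m \<le> real k * N" using of_nat_mono[OF kN] by simp
      also have "\<dots> \<le> (1 + 2 * log 2 m) * N" using k_le by (intro mult_right_mono) auto
      finally have "6 * real m / (1 + 2 * log 2 m) \<le> N"
        using log_m by (simp add: pos_divide_le_eq mult.commute)
      then have "6 * real m / (1 + 2 * log 2 m) / 128 \<le> real N / 128"
        by (rule divide_right_mono) simp
      with large(2) show ?thesis by (rule order_trans)
    qed
    \<comment> \<open>The threshold \<open>d\<close> balances two demands: the number of heavy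
      inputs must stay below \<open>t^2 / (8 * m)\<close>, of order \<open>m powr 0.7\<close>, and
      \<open>d^2 * n\<close> must stay below \<open>t^2\<close>. The test level \<open>t\<close> is
      half the guaranteed mean correlation.\<close>
    define d where "d = real m powr 0.33"
    define t where "t = real m powr 0.85 / 2"
    \<comment> \<open>For a mean of at least \<open>2 * t\<close> this minimises the resulting
      exponent \<open>- l * t + 10 * l^2 * d^2 * n\<close>.\<close>
    define l where "l = t / (20 * d\<^sup>2 * n)"
    have pos: "d > 0" "t > 0" "l > 0" using m n by (auto simp: d_def t_def l_def)
    have t2: "t\<^sup>2 = real m powr 1.7 / 4" and d2: "d\<^sup>2 = real m powr 0.66"
      by (simp_all add: t_def d_def power2_eq_square flip: powr_add)
    show ?thesis
    proof (intro exI[of _ "source_law n k N"] conjI ballI allI impI)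
      fix X assume X: "X \<in> set_pmf (source_law n k N)"
      show "set_pmf X \<subseteq> bitstrings n" "min_entropy X \<ge> 1.5 * real m"
        using source_law_support[OF X refl NB mn' kN] by auto
    next
      fix h :: "bool list \<Rightarrow> bool list"
      assume "(\<forall>x\<in>bitstrings n. h x \<in> bitstrings m) \<and>
          real (sparsity n m h) \<le> 0.001 * real n * log 2 (real m) * log 2 (2 * real n / real m)"
      then have s: "real (sparsity n m h) \<le> 0.001 * real n * log 2 (real m) * log 2 (2 * real n / real m)"
        by blast
      define H where "H = {i \<in> {..<n}. real (card (outputs_of n m h i)) > d}"
      define \<mu> where "\<mu> = (\<Sum>j<m. 4 powr (- real (card (inputs_of n h j)) / 2 ^ k))"
      have "real (card H) \<le> real (sparsity n m h) / d"
        unfolding H_def by (rule card_heavy_inputs[OF pos(1)])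
      also have "\<dots> \<le> 0.001 * real m powr (100/99) * log 2 m * (1 + 2 * log 2 m) / d"
      proof -
        have "log 2 (2 * real n / m) \<le> log 2 (2 * real n)"
          using n m by (intro log_mono) (auto simp: field_simps)
        then have "log 2 (2 * real n / m) \<le> 1 + 2 * log 2 m" using log2n by simp
        moreover have "log 2 (2 * real n / m) \<ge> 0"
          using mn' m n by (simp add: field_simps)
        ultimately have "0.001 * real n * log 2 m * log 2 (2 * real n / m) \<le>
            0.001 * real m powr (100/99) * log 2 m * (1 + 2 * log 2 m)"
          using n_le log_m by (intro mult_mono mult_nonneg_nonneg) auto
        with s show ?thesis using pos(1) by (intro divide_right_mono) auto
      qed
      finally have cardH: "real (card H) + real m powr 0.02 \<le> real m powr 0.7 / 32"
        using large(3) unfolding d_def by linarith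
      have test: "2 ^ card H * exp (- t\<^sup>2 / (8 * m)) \<le> exp (- (real m powr 0.02))"
      proof -
        have "(2::real) ^ card H \<le> exp 1 ^ card H"
          using exp_ge_add_one_self[of 1] by (intro power_mono) auto
        also have "\<dots> = exp (real (card H))" by (simp flip: exp_of_nat_mult)
        finally have "2 ^ card H * exp (- t\<^sup>2 / (8 * m)) \<le> exp (real (card H)) * exp (- t\<^sup>2 / (8 * m))"
          by (intro mult_right_mono) auto
        also have "\<dots> = exp (real (card H) - t\<^sup>2 / (8 * m))" by (simp flip: exp_add)
        also have "t\<^sup>2 / (8 * m) = real m powr 0.7 / 32"
        proof -
          have "real m powr 1.7 = real m powr (0.7 + 1)" by simp
          also have "\<dots> = real m powr 0.7 * m" unfolding powr_add using m by simp
          finally show ?thesis unfolding t2 using m by simp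
        qed
        also have "exp (real (card H) - real m powr 0.7 / 32) \<le> exp (- (real m powr 0.02))"
          using cardH by simp
        finally show ?thesis .
      qed
      have "\<mu> \<ge> 2 * t"
        using sum_powr_inputs_ge[OF m k small' mn' s] by (simp add: \<mu>_def t_def)
      then have "l * t - l * \<mu> + 10 * l\<^sup>2 * d\<^sup>2 * n \<le> l * t - l * (2 * t) + 10 * l\<^sup>2 * d\<^sup>2 * n"
        using pos by simp
      also have "\<dots> = - (t\<^sup>2 / (40 * d\<^sup>2 * n))"
        using pos n by (simp add: l_def field_simps power2_eq_square)
      also have "\<dots> \<le> - (real m powr 0.02)"
      proof -
        have "real m powr 0.02 \<le> real m powr 1.7 / (160 * real m powr 0.66 * real m powr (100/99))"
          by (rule large(4))
        also have "\<dots> \<le> real m powr 1.7 / (160 * real m powr 0.66 * n)"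
          using n_le n m by (intro divide_left_mono mult_left_mono) auto
        also have "\<dots> = t\<^sup>2 / (40 * d\<^sup>2 * n)" by (simp add: t2 d2)
        finally show ?thesis by simp
      qed
      finally have tail: "exp (l * t - l * \<mu> + 10 * l\<^sup>2 * d\<^sup>2 * n) \<le> exp (- (real m powr 0.02))"
        by simp
      have act: "exp (- real N / 128) \<le> exp (- (real m powr 0.02))" using N by simp
      \<comment> \<open>Each of the three losses is at most \<open>exp (- (m powr 0.02))\<close>;
        passing to the exponent 0.01 absorbs the factor 3.\<close>
      have "1 - exp (- real N / 128) - 2 ^ card H * exp (- t\<^sup>2 / (8 * m)) -
          exp (l * t - l * \<mu> + 10 * l\<^sup>2 * d\<^sup>2 * n) \<le>
          expect (source_law n k N) (\<lambda>X. stat_dist (map_pmf h X) (uniform_bits m))"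
        unfolding H_def \<mu>_def using expect_stat_dist_ge[OF refl k NB m _ pos(2,3)] pos(1) by simp
      moreover have "3 * exp (- (real m powr 0.02)) \<le> exp (- (real m powr 0.01))"
        by (rule large(5))
      ultimately show "expect (source_law n k N) (\<lambda>X. stat_dist (map_pmf h X) (uniform_bits m)) \<ge>
          1 - exp (- (real m powr 0.01))"
        using act test tail by linarith
    qed
  qed
  then show ?thesis by (intro exI[of _ "0.01"] conjI exI[of _ n0] allI impI) auto
qed

end
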